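(* Let $R$ be a ring. (1) If all right $R$-modules are regularly weakly based, then $R$ is right perfect. (2) Let $J$ denote the Jacobson radical of $R$. If $R$ is right perfect, then all right $R$-modules are regularly weakly based if and only if all right modules over the semisimple ring $R/J$ are regularly weakly based.
   Context: For a subset $X$ of a module $M$, $\operatorname{Span}(X)$ denotes the submodule generated by $X$. A subset $X$ of a module $M$ is weakly independent if $x \notin \operatorname{Span}(X \setminus \{x\})$ for all $x \in X$. A weak basis of $M$ is a weakly independent subset that generates $M$ (equivalently, a generating set minimal with respect to inclusion). A module $M$ is regularly weakly based if every generating set of $M$ contains a weak basis of $M$. A ring $R$ with Jacobson radical $J$ is right perfect if and only if $R/J$ is semisimple and $J$ is right T-nilpotent, that is, for every sequence $a_1, a_2, \dots$ of elements of $J$ there is a positive integer $n$ such that $a_n \cdots a_1 = 0$ (theorem of Bass). Part (1) is attributed to Nashier and Nichols. *)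

theory Defs
  imports "HOL-Algebra.Module" "HOL-Algebra.QuotRing" "HOL-Library.Equipollence"
begin

text \<open>
  The locale \<^locale>\<open>module\<close> of HOL-Algebra is restricted to left modules over commutative rings,
  so right modules over arbitrary unital rings are introduced here.  As in
  \<^typ>\<open>('a, 'b) module\<close>, the multiplication and unit inherited from \<^typ>\<open>'b ring\<close> are irrelevant.
\<close>

record ('a, 'b) right_module = "'b ring" +
  rsmult :: "['b, 'a] \<Rightarrow> 'b" (infixl \<open>\<cdot>\<index>\<close> 70)

locale right_module = R?: ring R + M?: abelian_group M
  for R :: "('a, 'c) ring_scheme" (structure)
    and M :: "('a, 'b, 'd) right_module_scheme" (structure) +
  assumes rsmult_closed:
      "\<lbrakk> x \<in> carrier M; a \<in> carrier R \<rbrakk> \<Longrightarrow> x \<cdot>\<^bsub>M\<^esub> a \<in> carrier M"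
    and rsmult_add_module:
      "\<lbrakk> x \<in> carrier M; y \<in> carrier M; a \<in> carrier R \<rbrakk> \<Longrightarrow>
       (x \<oplus>\<^bsub>M\<^esub> y) \<cdot>\<^bsub>M\<^esub> a = (x \<cdot>\<^bsub>M\<^esub> a) \<oplus>\<^bsub>M\<^esub> (y \<cdot>\<^bsub>M\<^esub> a)"
    and rsmult_add_ring:
      "\<lbrakk> x \<in> carrier M; a \<in> carrier R; b \<in> carrier R \<rbrakk> \<Longrightarrow>
       x \<cdot>\<^bsub>M\<^esub> (a \<oplus>\<^bsub>R\<^esub> b) = (x \<cdot>\<^bsub>M\<^esub> a) \<oplus>\<^bsub>M\<^esub> (x \<cdot>\<^bsub>M\<^esub> b)"
    and rsmult_assoc:
      "\<lbrakk> x \<in> carrier M; a \<in> carrier R; b \<in> carrier R \<rbrakk> \<Longrightarrow>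
       x \<cdot>\<^bsub>M\<^esub> (a \<otimes>\<^bsub>R\<^esub> b) = (x \<cdot>\<^bsub>M\<^esub> a) \<cdot>\<^bsub>M\<^esub> b"
    and rsmult_one:
      "x \<in> carrier M \<Longrightarrow> x \<cdot>\<^bsub>M\<^esub> \<one>\<^bsub>R\<^esub> = x"

definition right_submodule ::
    "'b set \<Rightarrow> ('a, 'c) ring_scheme \<Rightarrow> ('a, 'b, 'd) right_module_scheme \<Rightarrow> bool" where
  "right_submodule N R M \<longleftrightarrow>
     additive_subgroup N M \<and> (\<forall>x\<in>N. \<forall>a\<in>carrier R. x \<cdot>\<^bsub>M\<^esub> a \<in> N)"

definition Span ::
    "('a, 'c) ring_scheme \<Rightarrow> ('a, 'b, 'd) right_module_scheme \<Rightarrow> 'b set \<Rightarrow> 'b set" where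
  "Span R M X = \<Inter>{N. right_submodule N R M \<and> X \<subseteq> N}"


section \<open>Weak bases\<close>

definition weakly_independent ::
    "('a, 'c) ring_scheme \<Rightarrow> ('a, 'b, 'd) right_module_scheme \<Rightarrow> 'b set \<Rightarrow> bool" where
  "weakly_independent R M X \<longleftrightarrow> X \<subseteq> carrier M \<and> (\<forall>x\<in>X. x \<notin> Span R M (X - {x}))"

definition generates ::
    "('a, 'c) ring_scheme \<Rightarrow> ('a, 'b, 'd) right_module_scheme \<Rightarrow> 'b set \<Rightarrow> bool" where
  "generates R M X \<longleftrightarrow> X \<subseteq> carrier M \<and> Span R M X = carrier M"

definition weak_basis ::
    "('a, 'c) ring_scheme \<Rightarrow> ('a, 'b, 'd) right_module_scheme \<Rightarrow> 'b set \<Rightarrow> bool" where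
  "weak_basis R M X \<longleftrightarrow> weakly_independent R M X \<and> generates R M X"

definition regularly_weakly_based ::
    "('a, 'c) ring_scheme \<Rightarrow> ('a, 'b, 'd) right_module_scheme \<Rightarrow> bool" where
  "regularly_weakly_based R M \<longleftrightarrow>
     (\<forall>X. generates R M X \<longrightarrow> (\<exists>B\<subseteq>X. weak_basis R M B))"


section \<open>Right perfect rings\<close>

definition regular_right_module :: "('a, 'c) ring_scheme \<Rightarrow> ('a, 'a) right_module" where
  "regular_right_module R =
     \<lparr>carrier = carrier R, mult = mult R, one = one R, zero = zero R, add = add R,
      rsmult = mult R\<rparr>"

definition right_ideal :: "'a set \<Rightarrow> ('a, 'c) ring_scheme \<Rightarrow> bool" where
  "right_ideal I R \<longleftrightarrow> right_submodule I R (regular_right_module R)"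

definition maximal_right_ideal :: "'a set \<Rightarrow> ('a, 'c) ring_scheme \<Rightarrow> bool" where
  "maximal_right_ideal I R \<longleftrightarrow>
     right_ideal I R \<and> I \<noteq> carrier R \<and>
     (\<forall>K. right_ideal K R \<and> I \<subseteq> K \<longrightarrow> K = I \<or> K = carrier R)"

text \<open>
  Intersecting with the carrier only matters for the zero ring, which has no maximal right ideals.
\<close>

definition jacobson_radical :: "('a, 'c) ring_scheme \<Rightarrow> 'a set" where
  "jacobson_radical R = carrier R \<inter> \<Inter>{I. maximal_right_ideal I R}"

text \<open>A module is semisimple if every submodule is a direct summand.\<close>

definition semisimple_right_module ::
    "('a, 'c) ring_scheme \<Rightarrow> ('a, 'b, 'd) right_module_scheme \<Rightarrow> bool" where
  "semisimple_right_module R M \<longleftrightarrow>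
     (\<forall>N. right_submodule N R M \<longrightarrow>
       (\<exists>N'. right_submodule N' R M \<and> N \<inter> N' = {\<zero>\<^bsub>M\<^esub>} \<and> N <+>\<^bsub>M\<^esub> N' = carrier M))"

definition semisimple_ring :: "('a, 'c) ring_scheme \<Rightarrow> bool" where
  "semisimple_ring R \<longleftrightarrow> semisimple_right_module R (regular_right_module R)"

text \<open>The product of \<open>a n, \<dots>, a 1\<close> in this order; \<open>a 0\<close> is not used.\<close>

primrec rev_prod :: "('a, 'c) ring_scheme \<Rightarrow> (nat \<Rightarrow> 'a) \<Rightarrow> nat \<Rightarrow> 'a" where
  "rev_prod R a 0 = \<one>\<^bsub>R\<^esub>"
| "rev_prod R a (Suc n) = a (Suc n) \<otimes>\<^bsub>R\<^esub> rev_prod R a n"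

definition right_T_nilpotent :: "('a, 'c) ring_scheme \<Rightarrow> 'a set \<Rightarrow> bool" where
  "right_T_nilpotent R J \<longleftrightarrow>
     (\<forall>a. (\<forall>i\<ge>1. a i \<in> J) \<longrightarrow> (\<exists>n\<ge>1. rev_prod R a n = \<zero>\<^bsub>R\<^esub>))"

text \<open>
  Right perfect rings are taken in the form that does not mention projective covers, hence does not
  quantify over modules; Bass's theorem says that both forms agree.
\<close>

definition right_perfect :: "('a, 'c) ring_scheme \<Rightarrow> bool" where
  "right_perfect R \<longleftrightarrow>
     semisimple_ring (R Quot jacobson_radical R) \<and> right_T_nilpotent R (jacobson_radical R)"


section \<open>All right modules\<close>

text \<open>
  A formula cannot quantify over all types, so the class of all right modules is represented by
  the modules whose carrier lies in a type \<open>'m\<close>, which plays the role of a universe and is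
  arbitrary in theorems.  The type argument is explicit.
\<close>

definition all_right_modules_rwb :: "'m itself \<Rightarrow> ('a, 'c) ring_scheme \<Rightarrow> bool" where
  "all_right_modules_rwb (_ :: 'm itself) R \<longleftrightarrow>
     (\<forall>M :: ('a, 'm) right_module. right_module R M \<longrightarrow> regularly_weakly_based R M)"

text \<open>
  If \<open>'m\<close> is too small, it may contain no interesting \<open>R\<close>-modules at all (on the type \<open>unit\<close>
  only the zero module lives).  The universe is large enough when it has room for
  \<open>\<nat> \<times> R\<close>, that is, for all countably generated right \<open>R\<close>-modules up to isomorphism.
\<close>

definition large_universe :: "'m itself \<Rightarrow> ('a, 'c) ring_scheme \<Rightarrow> bool" where
  "large_universe (_ :: 'm itself) R \<longleftrightarrow>
     (UNIV :: nat set) \<times> carrier R \<lesssim> (UNIV :: 'm set)"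

end

theory Submission
  imports Defs "HOL-Algebra.Multiplicative_Group"
begin

text \<open>
  Part (1) rests on one observation.  Let a module be the union of a chain of cyclic submodules,
  with generators \<open>m i = m (i + 1) \<cdot> a i\<close>.  Of two of these generators, one lies in the span of the
  other, so a weak basis consisting of generators has at most one element.  If the module is
  regularly weakly based, some \<open>m n\<close> therefore generates it and the chain is stationary
  (\<open>cyclic_chain_stationary\<close>).  The union of the chain has at most as many elements as \<open>\<nat> \<times> R\<close>, which
  is why a large universe contains all modules to which this has to be applied
  (\<open>chain_stationary_modulo_submodule\<close>).

  Two chains suffice.  The first lives in the direct limit of \<open>R \<rightarrow> R \<rightarrow> \<dots>\<close> under left
  multiplications by \<open>a 1, a 2, \<dots>\<close>.  That it is stationary means
  \<open>a k \<dots> a (n + 2) = a k \<dots> a (n + 1) c\<close> for some \<open>n\<close>, \<open>k\<close> and \<open>c\<close>.  If \<open>a (n + 1)\<close> is in the radical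
  \<open>J\<close>, then \<open>1 - a (n + 1) c\<close> is right invertible and the product on the left vanishes, so \<open>J\<close> is right
  T-nilpotent.  For a constant sequence one finds \<open>b\<^sup>k = b\<^sup>k b c\<close> for each \<open>b\<close>.  The second kind of chain
  lives in the ring itself and yields the ascending chain condition on principal right ideals.

  Both conditions pass to \<open>R/J\<close>, whose modules are \<open>R\<close>-modules.  Together they provide a nonzero
  idempotent in \<open>bS\<close> for each non-nilpotent element \<open>b\<close> of \<open>S = R/J\<close> (\<open>idempotent_multiple_exists\<close>).  Since no
  nonzero right ideal of \<open>S\<close> is nil, each of them contains a nonzero idempotent; with the chain
  condition, each is then generated by an idempotent and has a complement (\<open>semisimple_ringI\<close>).

  For part (2), let \<open>X\<close> generate an \<open>R\<close>-module \<open>M\<close>.  The image of \<open>X\<close> in the \<open>R/J\<close>-module \<open>M/MJ\<close>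
  contains a weak basis, and its elements have distinct preimages in \<open>X\<close>.  These preimages are
  weakly independent because their images are, and they generate \<open>M\<close> by Nakayama's lemma,
  which holds for all right modules as \<open>J\<close> is right T-nilpotent (\<open>T_nilpotent_Nakayama\<close>).
\<close>

section \<open>Submodules and spans\<close>

context right_module
begin

lemma rsmult_zero_left:
  assumes "a \<in> carrier R"
  shows "\<zero>\<^bsub>M\<^esub> \<cdot>\<^bsub>M\<^esub> a = \<zero>\<^bsub>M\<^esub>"
proof -
  have "(\<zero>\<^bsub>M\<^esub> \<cdot>\<^bsub>M\<^esub> a) \<oplus>\<^bsub>M\<^esub> (\<zero>\<^bsub>M\<^esub> \<cdot>\<^bsub>M\<^esub> a) = \<zero>\<^bsub>M\<^esub> \<cdot>\<^bsub>M\<^esub> a"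
    using rsmult_add_module[of "\<zero>\<^bsub>M\<^esub>" "\<zero>\<^bsub>M\<^esub>" a] assms by simp
  then show ?thesis
    using rsmult_closed[of "\<zero>\<^bsub>M\<^esub>" a] assms M.add.l_cancel_one by simp
qed

lemma rsmult_zero_right:
  assumes "x \<in> carrier M"
  shows "x \<cdot>\<^bsub>M\<^esub> \<zero>\<^bsub>R\<^esub> = \<zero>\<^bsub>M\<^esub>"
proof -
  have "(x \<cdot>\<^bsub>M\<^esub> \<zero>\<^bsub>R\<^esub>) \<oplus>\<^bsub>M\<^esub> (x \<cdot>\<^bsub>M\<^esub> \<zero>\<^bsub>R\<^esub>) = x \<cdot>\<^bsub>M\<^esub> \<zero>\<^bsub>R\<^esub>"
    using rsmult_add_ring[of x "\<zero>\<^bsub>R\<^esub>" "\<zero>\<^bsub>R\<^esub>"] assms by simp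
  then show ?thesis
    using rsmult_closed[of x "\<zero>\<^bsub>R\<^esub>"] assms M.add.l_cancel_one by simp
qed

lemma rsmult_minus_left:
  assumes "x \<in> carrier M" "a \<in> carrier R"
  shows "(\<ominus>\<^bsub>M\<^esub> x) \<cdot>\<^bsub>M\<^esub> a = \<ominus>\<^bsub>M\<^esub> (x \<cdot>\<^bsub>M\<^esub> a)"
proof -
  have "((\<ominus>\<^bsub>M\<^esub> x) \<cdot>\<^bsub>M\<^esub> a) \<oplus>\<^bsub>M\<^esub> (x \<cdot>\<^bsub>M\<^esub> a) = \<zero>\<^bsub>M\<^esub>"
    using rsmult_add_module[of "\<ominus>\<^bsub>M\<^esub> x" x a] assms by (simp add: M.l_neg rsmult_zero_left)
  then show ?thesis
    using M.minus_equality assms rsmult_closed by simp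
qed

lemma rsmult_minus_right:
  assumes "x \<in> carrier M" "a \<in> carrier R"
  shows "x \<cdot>\<^bsub>M\<^esub> (\<ominus>\<^bsub>R\<^esub> a) = \<ominus>\<^bsub>M\<^esub> (x \<cdot>\<^bsub>M\<^esub> a)"
proof -
  have "(x \<cdot>\<^bsub>M\<^esub> (\<ominus>\<^bsub>R\<^esub> a)) \<oplus>\<^bsub>M\<^esub> (x \<cdot>\<^bsub>M\<^esub> a) = \<zero>\<^bsub>M\<^esub>"
    using rsmult_add_ring[of x "\<ominus>\<^bsub>R\<^esub> a" a] assms by (simp add: R.l_neg rsmult_zero_right)
  then show ?thesis
    using M.minus_equality assms rsmult_closed by simp
qed

lemma right_submoduleI:
  assumes sub: "N \<subseteq> carrier M" and z: "\<zero>\<^bsub>M\<^esub> \<in> N"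
    and add: "\<And>x y. x \<in> N \<Longrightarrow> y \<in> N \<Longrightarrow> x \<oplus>\<^bsub>M\<^esub> y \<in> N"
    and smult: "\<And>x a. x \<in> N \<Longrightarrow> a \<in> carrier R \<Longrightarrow> x \<cdot>\<^bsub>M\<^esub> a \<in> N"
  shows "right_submodule N R M"
proof -
  have minus: "\<ominus>\<^bsub>M\<^esub> x \<in> N" if "x \<in> N" for x
  proof -
    have x: "x \<in> carrier M" using that sub by blast
    have "x \<cdot>\<^bsub>M\<^esub> (\<ominus>\<^bsub>R\<^esub> \<one>\<^bsub>R\<^esub>) = \<ominus>\<^bsub>M\<^esub> x"
      using rsmult_minus_right[of x "\<one>\<^bsub>R\<^esub>"] x by (simp add: rsmult_one)
    then show ?thesis using smult[OF that, of "\<ominus>\<^bsub>R\<^esub> \<one>\<^bsub>R\<^esub>"] by simp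
  qed
  have "subgroup N (add_monoid M)"
    by (rule M.add.subgroupI) (use assms minus in \<open>auto simp: a_inv_def\<close>)
  then show ?thesis
    unfolding right_submodule_def using smult by (simp add: additive_subgroup_def)
qed

lemma
  assumes N: "right_submodule N R M"
  shows right_submodule_subset: "N \<subseteq> carrier M"
    and right_submodule_zero: "\<zero>\<^bsub>M\<^esub> \<in> N"
    and right_submodule_add: "x \<in> N \<Longrightarrow> y \<in> N \<Longrightarrow> x \<oplus>\<^bsub>M\<^esub> y \<in> N"
    and right_submodule_minus: "x \<in> N \<Longrightarrow> \<ominus>\<^bsub>M\<^esub> x \<in> N"
    and right_submodule_diff: "x \<in> N \<Longrightarrow> y \<in> N \<Longrightarrow> x \<ominus>\<^bsub>M\<^esub> y \<in> N"
    and right_submodule_rsmult: "x \<in> N \<Longrightarrow> a \<in> carrier R \<Longrightarrow> x \<cdot>\<^bsub>M\<^esub> a \<in> N"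
proof -
  interpret N: additive_subgroup N M using N by (simp add: right_submodule_def)
  show "N \<subseteq> carrier M" "\<zero>\<^bsub>M\<^esub> \<in> N"
    using N.a_subset N.zero_closed by auto
  show add: "x \<oplus>\<^bsub>M\<^esub> y \<in> N" if "x \<in> N" "y \<in> N" for x y
    using N.a_closed that by blast
  show min: "\<ominus>\<^bsub>M\<^esub> x \<in> N" if "x \<in> N" for x
    using N.a_inv_closed that M.abelian_group_axioms by blast
  show "x \<ominus>\<^bsub>M\<^esub> y \<in> N" if "x \<in> N" "y \<in> N" for x y
    using add min that by (simp add: a_minus_def)
  show "x \<cdot>\<^bsub>M\<^esub> a \<in> N" if "x \<in> N" "a \<in> carrier R" for x a
    using N that by (auto simp: right_submodule_def)
qed

lemma
  assumes Z: "right_submodule Z R M" and car: "x \<in> carrier M" "y \<in> carrier M"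
  shows diff_submodule_sym: "x \<ominus>\<^bsub>M\<^esub> y \<in> Z \<Longrightarrow> y \<ominus>\<^bsub>M\<^esub> x \<in> Z"
    and diff_submodule_trans:
      "z \<in> carrier M \<Longrightarrow> x \<ominus>\<^bsub>M\<^esub> y \<in> Z \<Longrightarrow> y \<ominus>\<^bsub>M\<^esub> z \<in> Z \<Longrightarrow> x \<ominus>\<^bsub>M\<^esub> z \<in> Z"
    and diff_submodule_add:
      "x' \<in> carrier M \<Longrightarrow> y' \<in> carrier M \<Longrightarrow> x \<ominus>\<^bsub>M\<^esub> y \<in> Z \<Longrightarrow> x' \<ominus>\<^bsub>M\<^esub> y' \<in> Z \<Longrightarrow>
        (x \<oplus>\<^bsub>M\<^esub> x') \<ominus>\<^bsub>M\<^esub> (y \<oplus>\<^bsub>M\<^esub> y') \<in> Z"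
    and diff_submodule_rsmult:
      "a \<in> carrier R \<Longrightarrow> x \<ominus>\<^bsub>M\<^esub> y \<in> Z \<Longrightarrow> (x \<cdot>\<^bsub>M\<^esub> a) \<ominus>\<^bsub>M\<^esub> (y \<cdot>\<^bsub>M\<^esub> a) \<in> Z"
proof -
  have "\<ominus>\<^bsub>M\<^esub> (x \<ominus>\<^bsub>M\<^esub> y) = y \<ominus>\<^bsub>M\<^esub> x"
    using car by (simp add: a_minus_def M.minus_add M.a_comm)
  then show "y \<ominus>\<^bsub>M\<^esub> x \<in> Z" if "x \<ominus>\<^bsub>M\<^esub> y \<in> Z"
    using right_submodule_minus[OF Z that] by simp
  show "x \<ominus>\<^bsub>M\<^esub> z \<in> Z" if "z \<in> carrier M" "x \<ominus>\<^bsub>M\<^esub> y \<in> Z" "y \<ominus>\<^bsub>M\<^esub> z \<in> Z"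
  proof -
    have "(x \<ominus>\<^bsub>M\<^esub> y) \<oplus>\<^bsub>M\<^esub> (y \<ominus>\<^bsub>M\<^esub> z) = x \<ominus>\<^bsub>M\<^esub> z"
      using car that by (simp add: a_minus_def M.a_assoc M.r_neg1)
    then show ?thesis using right_submodule_add[OF Z that(2,3)] by simp
  qed
  show "(x \<oplus>\<^bsub>M\<^esub> x') \<ominus>\<^bsub>M\<^esub> (y \<oplus>\<^bsub>M\<^esub> y') \<in> Z"
    if "x' \<in> carrier M" "y' \<in> carrier M" "x \<ominus>\<^bsub>M\<^esub> y \<in> Z" "x' \<ominus>\<^bsub>M\<^esub> y' \<in> Z"
  proof -
    have "(x \<oplus>\<^bsub>M\<^esub> x') \<ominus>\<^bsub>M\<^esub> (y \<oplus>\<^bsub>M\<^esub> y') = (x \<ominus>\<^bsub>M\<^esub> y) \<oplus>\<^bsub>M\<^esub> (x' \<ominus>\<^bsub>M\<^esub> y')"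
      using car that by (simp add: a_minus_def M.minus_add M.a_ac)
    then show ?thesis using right_submodule_add[OF Z that(3,4)] by simp
  qed
  show "(x \<cdot>\<^bsub>M\<^esub> a) \<ominus>\<^bsub>M\<^esub> (y \<cdot>\<^bsub>M\<^esub> a) \<in> Z" if "a \<in> carrier R" "x \<ominus>\<^bsub>M\<^esub> y \<in> Z"
  proof -
    have "(x \<cdot>\<^bsub>M\<^esub> a) \<ominus>\<^bsub>M\<^esub> (y \<cdot>\<^bsub>M\<^esub> a) = (x \<ominus>\<^bsub>M\<^esub> y) \<cdot>\<^bsub>M\<^esub> a"
      using car that by (simp add: a_minus_def rsmult_add_module rsmult_minus_left)
    then show ?thesis using right_submodule_rsmult[OF Z that(2,1)] by simp
  qed
qed

lemma right_submodule_carrier: "right_submodule (carrier M) R M"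
  by (rule right_submoduleI) (auto simp: rsmult_closed)

lemma right_submodule_zero_set: "right_submodule {\<zero>\<^bsub>M\<^esub>} R M"
  by (rule right_submoduleI) (auto simp: rsmult_zero_left)

lemma Span_least: "right_submodule N R M \<Longrightarrow> X \<subseteq> N \<Longrightarrow> Span R M X \<subseteq> N"
  by (auto simp: Span_def)

lemma Span_superset: "X \<subseteq> Span R M X"
  by (auto simp: Span_def)

lemma Span_mono: "X \<subseteq> Y \<Longrightarrow> Span R M X \<subseteq> Span R M Y"
  by (auto simp: Span_def)

lemma right_submodule_Span:
  assumes "X \<subseteq> carrier M"
  shows "right_submodule (Span R M X) R M"
proof (rule right_submoduleI)
  show "Span R M X \<subseteq> carrier M"
    using Span_least[OF right_submodule_carrier assms] .
qed (auto simp: Span_def right_submodule_zero right_submodule_add right_submodule_rsmult)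

lemma right_submodule_multiples:
  assumes "x \<in> carrier M"
  shows "right_submodule ((\<lambda>a. x \<cdot>\<^bsub>M\<^esub> a) ` carrier R) R M"
proof (rule right_submoduleI)
  show "\<zero>\<^bsub>M\<^esub> \<in> (\<lambda>a. x \<cdot>\<^bsub>M\<^esub> a) ` carrier R"
    using rsmult_zero_right[OF assms] by force
next
  fix u v assume "u \<in> (\<lambda>a. x \<cdot>\<^bsub>M\<^esub> a) ` carrier R" "v \<in> (\<lambda>a. x \<cdot>\<^bsub>M\<^esub> a) ` carrier R"
  then obtain a b where "a \<in> carrier R" "b \<in> carrier R" "u = x \<cdot>\<^bsub>M\<^esub> a" "v = x \<cdot>\<^bsub>M\<^esub> b" by blast
  then show "u \<oplus>\<^bsub>M\<^esub> v \<in> (\<lambda>a. x \<cdot>\<^bsub>M\<^esub> a) ` carrier R"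
    by (auto intro!: image_eqI[of _ _ "a \<oplus>\<^bsub>R\<^esub> b"] simp: rsmult_add_ring assms)
next
  fix u b assume "u \<in> (\<lambda>a. x \<cdot>\<^bsub>M\<^esub> a) ` carrier R" "b \<in> carrier R"
  then obtain a where "a \<in> carrier R" "b \<in> carrier R" "u = x \<cdot>\<^bsub>M\<^esub> a" by blast
  then show "u \<cdot>\<^bsub>M\<^esub> b \<in> (\<lambda>a. x \<cdot>\<^bsub>M\<^esub> a) ` carrier R"
    by (auto intro!: image_eqI[of _ _ "a \<otimes>\<^bsub>R\<^esub> b"] simp: rsmult_assoc assms)
qed (auto simp: rsmult_closed assms)

lemma Span_singleton:
  assumes "x \<in> carrier M"
  shows "Span R M {x} = (\<lambda>a. x \<cdot>\<^bsub>M\<^esub> a) ` carrier R"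
proof
  show "Span R M {x} \<subseteq> (\<lambda>a. x \<cdot>\<^bsub>M\<^esub> a) ` carrier R"
    by (rule Span_least[OF right_submodule_multiples[OF assms]])
      (use rsmult_one[OF assms] in force)
  show "(\<lambda>a. x \<cdot>\<^bsub>M\<^esub> a) ` carrier R \<subseteq> Span R M {x}"
    using right_submodule_rsmult[OF right_submodule_Span] Span_superset[of "{x}"] assms by blast
qed

text \<open>
  In a union of an ascending chain of cyclic submodules, two distinct chosen generators are
  never weakly independent.  So the generators contain a weak basis only if one of them
  already generates everything.
\<close>

lemma cyclic_chain_stationary:
  fixes m :: "nat \<Rightarrow> 'b"
  assumes rwb: "regularly_weakly_based R M"
    and m: "\<And>i. m i \<in> carrier M" and a: "\<And>i. a i \<in> carrier R"
    and chain: "\<And>i. m i = m (Suc i) \<cdot>\<^bsub>M\<^esub> a i"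
    and cover: "carrier M = (\<Union>i. Span R M {m i})"
  shows "\<exists>n. \<exists>c\<in>carrier R. m (Suc n) = m n \<cdot>\<^bsub>M\<^esub> c"
proof -
  have sub: "right_submodule (Span R M X) R M" if "X \<subseteq> range m" for X
    using that m by (intro right_submodule_Span) auto
  have "generates R M (range m)"
    unfolding generates_def
    using m right_submodule_subset[OF sub[of "range m"]] Span_mono[of "{m _}" "range m"] cover
    by blast
  then obtain B where B: "B \<subseteq> range m" "weakly_independent R M B" "generates R M B"
    using rwb by (auto simp: regularly_weakly_based_def weak_basis_def)
  have step: "m i \<in> Span R M {m (i + k)}" for i k
  proof (induction k)
    case 0 then show ?case using Span_superset by auto
  next
    case (Suc k)
    have "m (i + k) \<in> Span R M {m (i + Suc k)}"
      using Span_singleton[OF m] chain[of "i + k"] a by auto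
    then have "Span R M {m (i + k)} \<subseteq> Span R M {m (i + Suc k)}"
      by (intro Span_least sub) auto
    then show ?case using Suc by blast
  qed
  have same: "m i = m j" if "m i \<in> B" "m j \<in> B" "i \<le> j" for i j
  proof (rule ccontr)
    assume "m i \<noteq> m j"
    then have "Span R M {m j} \<subseteq> Span R M (B - {m i})" using that by (intro Span_mono) auto
    then have "m i \<in> Span R M (B - {m i})" using step[of i "j - i"] that by auto
    then show False using B that by (auto simp: weakly_independent_def)
  qed
  show ?thesis
  proof (cases "B = {}")
    case True
    then have "carrier M \<subseteq> {\<zero>\<^bsub>M\<^esub>}"
      using B Span_least[OF right_submodule_zero_set, of "{}"] by (auto simp: generates_def)
    then have "m 1 = m 0 \<cdot>\<^bsub>M\<^esub> \<zero>\<^bsub>R\<^esub>" using m rsmult_zero_right by auto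
    then show ?thesis by (intro exI[of _ 0] bexI[of _ "\<zero>\<^bsub>R\<^esub>"]) auto
  next
    case False
    then obtain n where n: "m n \<in> B" using B by blast
    have "B = {m n}"
    proof -
      have "m i = m n" if "m i \<in> B" for i
        using same[of i n] same[of n i] that n by (metis nat_le_linear)
      then show ?thesis using B n by blast
    qed
    then have "m (Suc n) \<in> Span R M {m n}" using B m by (auto simp: generates_def)
    then show ?thesis using Span_singleton[OF m] by auto
  qed
qed

end

text \<open>
  Whether a module is regularly weakly based depends only on its carrier and on its lattice of
  submodules, not on the ring.
\<close>

lemma regularly_weakly_based_cong:
  assumes "carrier M = carrier M'"
    and "\<And>N. right_submodule N R M \<longleftrightarrow> right_submodule N S M'"
  shows "regularly_weakly_based R M \<longleftrightarrow> regularly_weakly_based S M'"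
proof -
  have "Span R M = Span S M'" using assms(2) by (auto simp: Span_def fun_eq_iff)
  then show ?thesis
    using assms(1)
    by (simp add: regularly_weakly_based_def weak_basis_def weakly_independent_def generates_def)
qed

section \<open>Constructions of modules\<close>

lemma regular_right_module_simps [simp]:
  "carrier (regular_right_module R) = carrier R"
  "add (regular_right_module R) = add R"
  "zero (regular_right_module R) = zero R"
  "rsmult (regular_right_module R) = mult R"
  by (simp_all add: regular_right_module_def)

text \<open>The additive group of a module does not see the scalars.\<close>

lemma abelian_group_cong:
  assumes "abelian_group M" and eq: "carrier G = carrier M" "add G = add M" "zero G = zero M"
  shows "abelian_group G"
proof -
  interpret M: abelian_group M by fact
  show ?thesis
  proof (rule abelian_groupI)
    fix x assume "x \<in> carrier G"
    then show "\<exists>y\<in>carrier G. y \<oplus>\<^bsub>G\<^esub> x = \<zero>\<^bsub>G\<^esub>"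
      by (intro bexI[of _ "\<ominus>\<^bsub>M\<^esub> x"]) (auto simp: eq M.l_neg)
  qed (auto simp: eq M.a_ac)
qed

lemma additive_subgroup_cong:
  assumes "carrier G = carrier M" "add G = add M" "zero G = zero M"
  shows "additive_subgroup N G \<longleftrightarrow> additive_subgroup N M"
  using assms by (simp add: additive_subgroup_def subgroup_def m_inv_def)

lemma (in ring) right_module_regular: "right_module R (regular_right_module R)"
  by (intro right_module.intro right_module_axioms.intro ring_axioms
      abelian_group_cong[OF abelian_group_axioms])
    (auto simp: l_distr r_distr m_assoc)

lemma a_inv_regular [simp]: "\<ominus>\<^bsub>regular_right_module R\<^esub> x = \<ominus>\<^bsub>R\<^esub> x"
  by (simp add: a_inv_def m_inv_def)

lemma a_minus_regular [simp]: "x \<ominus>\<^bsub>regular_right_module R\<^esub> y = x \<ominus>\<^bsub>R\<^esub> y"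
  by (simp add: a_minus_def)

text \<open>
  Both quotient modules and copies of modules in another type are homomorphic images: the
  structure on the image is the one that makes \<open>q\<close> a homomorphism, and it exists when the
  fibres of \<open>q\<close> are the cosets of a submodule.
\<close>

definition image_module ::
    "('a, 'b, 'd) right_module_scheme \<Rightarrow> 'b set \<Rightarrow> ('b \<Rightarrow> 'm) \<Rightarrow> ('a, 'm) right_module" where
  "image_module P N q =
     \<lparr>carrier = q ` N, mult = (\<lambda>_ _. q \<zero>\<^bsub>P\<^esub>), one = q \<zero>\<^bsub>P\<^esub>, zero = q \<zero>\<^bsub>P\<^esub>,
      add = (\<lambda>u v. q (inv_into N q u \<oplus>\<^bsub>P\<^esub> inv_into N q v)),
      rsmult = (\<lambda>u a. q (inv_into N q u \<cdot>\<^bsub>P\<^esub> a))\<rparr>"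

lemma image_module_simps [simp]:
  "carrier (image_module P N q) = q ` N"
  "\<zero>\<^bsub>image_module P N q\<^esub> = q \<zero>\<^bsub>P\<^esub>"
  by (simp_all add: image_module_def)

locale coset_map = P?: right_module R P
  for R :: "('a, 'c) ring_scheme" (structure)
    and P :: "('a, 'b, 'd) right_module_scheme" (structure) +
  fixes N Z :: "'b set" and q :: "'b \<Rightarrow> 'm"
  assumes N: "right_submodule N R P" and Z: "right_submodule Z R P"
    and q_eq_iff: "\<And>x y. x \<in> N \<Longrightarrow> y \<in> N \<Longrightarrow> q x = q y \<longleftrightarrow> x \<ominus>\<^bsub>P\<^esub> y \<in> Z"
begin

lemma in_carrier: "x \<in> N \<Longrightarrow> x \<in> carrier P"
  using right_submodule_subset[OF N] by blast

lemma representative: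
  assumes "x \<in> N"
  shows "inv_into N q (q x) \<in> N" "q (inv_into N q (q x)) = q x"
  using assms by (auto intro: inv_into_into f_inv_into_f)

lemma q_add:
  assumes x: "x \<in> N" and y: "y \<in> N"
  shows "q x \<oplus>\<^bsub>image_module P N q\<^esub> q y = q (x \<oplus>\<^bsub>P\<^esub> y)"
proof -
  define x' y' where "x' = inv_into N q (q x)" and "y' = inv_into N q (q y)"
  have x': "x' \<in> N" "x' \<ominus>\<^bsub>P\<^esub> x \<in> Z" and y': "y' \<in> N" "y' \<ominus>\<^bsub>P\<^esub> y \<in> Z"
    using representative[OF x] representative[OF y] q_eq_iff x y by (auto simp: x'_def y'_def)
  note car = in_carrier[OF x] in_carrier[OF y] in_carrier[OF x'(1)] in_carrier[OF y'(1)]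
  have "(x' \<oplus>\<^bsub>P\<^esub> y') \<ominus>\<^bsub>P\<^esub> (x \<oplus>\<^bsub>P\<^esub> y) \<in> Z"
    using diff_submodule_add[OF Z] car x' y' by blast
  then have "q (x' \<oplus>\<^bsub>P\<^esub> y') = q (x \<oplus>\<^bsub>P\<^esub> y)"
    using q_eq_iff right_submodule_add[OF N] x y x' y' by simp
  then show ?thesis by (simp add: image_module_def x'_def y'_def)
qed

lemma q_rsmult:
  assumes x: "x \<in> N" and a: "a \<in> carrier R"
  shows "q x \<cdot>\<^bsub>image_module P N q\<^esub> a = q (x \<cdot>\<^bsub>P\<^esub> a)"
proof -
  define x' where "x' = inv_into N q (q x)"
  have x': "x' \<in> N" "x' \<ominus>\<^bsub>P\<^esub> x \<in> Z"
    using representative[OF x] q_eq_iff x by (auto simp: x'_def)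
  note car = in_carrier[OF x] in_carrier[OF x'(1)]
  have "(x' \<cdot>\<^bsub>P\<^esub> a) \<ominus>\<^bsub>P\<^esub> (x \<cdot>\<^bsub>P\<^esub> a) \<in> Z"
    using diff_submodule_rsmult[OF Z] car x' a by blast
  then have "q (x' \<cdot>\<^bsub>P\<^esub> a) = q (x \<cdot>\<^bsub>P\<^esub> a)"
    using q_eq_iff right_submodule_rsmult[OF N] x x' a by simp
  then show ?thesis by (simp add: image_module_def x'_def)
qed

lemma right_module_image: "right_module R (image_module P N q)"
proof -
  note closed = right_submodule_zero[OF N] right_submodule_add[OF N] right_submodule_minus[OF N]
    right_submodule_rsmult[OF N]
  have "abelian_group (image_module P N q)"
  proof (rule abelian_groupI)
    fix u assume "u \<in> carrier (image_module P N q)"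
    then obtain x where x: "x \<in> N" "u = q x" by auto
    then show "\<exists>v\<in>carrier (image_module P N q).
        v \<oplus>\<^bsub>image_module P N q\<^esub> u = \<zero>\<^bsub>image_module P N q\<^esub>"
      by (intro bexI[of _ "q (\<ominus>\<^bsub>P\<^esub> x)"]) (auto simp: q_add closed in_carrier P.M.l_neg)
  qed (auto simp: q_add closed in_carrier P.M.a_ac)
  then show ?thesis
    by (intro right_module.intro right_module_axioms.intro ring_axioms)
      (auto simp: q_add q_rsmult closed in_carrier rsmult_add_module rsmult_add_ring rsmult_assoc
        rsmult_one)
qed

text \<open>The preimage of a submodule is a submodule, so \<open>q\<close> maps spans onto spans.\<close>

lemma right_submodule_preimage:
  assumes "right_submodule K R (image_module P N q)"
  shows "right_submodule {x \<in> N. q x \<in> K} R P"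
proof -
  interpret Q: right_module R "image_module P N q" by (rule right_module_image)
  note closed = right_submodule_zero[OF N] right_submodule_add[OF N] right_submodule_rsmult[OF N]
  show ?thesis
    using Q.right_submodule_zero[OF assms] Q.right_submodule_add[OF assms]
      Q.right_submodule_rsmult[OF assms]
    by (intro right_submoduleI) (auto simp: closed in_carrier q_add[symmetric] q_rsmult[symmetric])
qed

lemma right_submodule_image:
  assumes "right_submodule K R P" "K \<subseteq> N"
  shows "right_submodule (q ` K) R (image_module P N q)"
proof -
  interpret Q: right_module R "image_module P N q" by (rule right_module_image)
  have N: "x \<in> K \<Longrightarrow> x \<in> N" for x using assms by blast
  show ?thesis
  proof (rule Q.right_submoduleI)
    fix u v assume "u \<in> q ` K" "v \<in> q ` K"
    then obtain x y where "x \<in> K" "u = q x" "y \<in> K" "v = q y" by blast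
    then show "u \<oplus>\<^bsub>image_module P N q\<^esub> v \<in> q ` K"
      using right_submodule_add[OF assms(1)] by (auto simp: q_add N)
  next
    fix u a assume "u \<in> q ` K" "a \<in> carrier R"
    then obtain x where "x \<in> K" "u = q x" "a \<in> carrier R" by blast
    then show "u \<cdot>\<^bsub>image_module P N q\<^esub> a \<in> q ` K"
      using right_submodule_rsmult[OF assms(1)] by (auto simp: q_rsmult N)
  qed (use assms right_submodule_zero[OF assms(1)] in auto)
qed

lemma Span_image:
  assumes "X \<subseteq> N"
  shows "Span R (image_module P N q) (q ` X) = q ` Span R P X"
proof
  interpret Q: right_module R "image_module P N q" by (rule right_module_image)
  have XP: "X \<subseteq> carrier P" using assms in_carrier by blast
  have le: "Span R P X \<subseteq> N" by (rule Span_least[OF N assms])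
  show "Span R (image_module P N q) (q ` X) \<subseteq> q ` Span R P X"
    using Span_superset[of X]
    by (intro Q.Span_least right_submodule_image right_submodule_Span XP le) auto
  have "right_submodule (Span R (image_module P N q) (q ` X)) R (image_module P N q)"
    using assms by (intro Q.right_submodule_Span) auto
  then have "Span R P X \<subseteq> {x \<in> N. q x \<in> Span R (image_module P N q) (q ` X)}"
    using Q.Span_superset[of "q ` X"] assms by (intro Span_least right_submodule_preimage) auto
  then show "q ` Span R P X \<subseteq> Span R (image_module P N q) (q ` X)" by blast
qed

end


text \<open>
  This transfers \<open>cyclic_chain_stationary\<close> to a chain modulo \<open>Z\<close> in a module over any type.  In the
  quotient of the submodule that the chain generates, each class has a representative \<open>m n \<cdot> r\<close>, so the quotient has at most as many elements
  as \<open>\<nat> \<times> R\<close> and therefore a copy in the universe.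
\<close>

lemma chain_stationary_modulo_submodule:
  fixes R :: "('a, 'c) ring_scheme" and P :: "('a, 'b, 'd) right_module_scheme"
  assumes P: "right_module R P" and Z: "right_submodule Z R P"
    and large: "large_universe TYPE('m) R" and rwb: "all_right_modules_rwb TYPE('m) R"
    and m: "\<And>i. m i \<in> carrier P" and a: "\<And>i. a i \<in> carrier R"
    and chain: "\<And>i. m i \<ominus>\<^bsub>P\<^esub> (m (Suc i) \<cdot>\<^bsub>P\<^esub> a i) \<in> Z"
  shows "\<exists>n. \<exists>c\<in>carrier R. m (Suc n) \<ominus>\<^bsub>P\<^esub> (m n \<cdot>\<^bsub>P\<^esub> c) \<in> Z"
proof -
  interpret P: right_module R P by (rule P)
  note car = m P.rsmult_closed P.R.add.m_closed P.R.m_closed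
  note trans = P.diff_submodule_trans[OF Z]
  \<comment> \<open>\<open>near x n r\<close>: the classes of \<open>x\<close> and \<open>m n \<cdot> r\<close> modulo \<open>Z\<close> agree.\<close>
  define near where "near x n r \<longleftrightarrow> r \<in> carrier R \<and> x \<ominus>\<^bsub>P\<^esub> (m n \<cdot>\<^bsub>P\<^esub> r) \<in> Z" for x n r
  define N where "N = {x \<in> carrier P. \<exists>n r. near x n r}"
  have N_car: "x \<in> N \<Longrightarrow> x \<in> carrier P" for x by (simp add: N_def)
  have refl: "x \<ominus>\<^bsub>P\<^esub> x \<in> Z" if "x \<in> carrier P" for x
    using that P.right_submodule_zero[OF Z] by (simp add: a_minus_def P.M.r_neg)
  \<comment> \<open>Representatives can be moved along the chain, so any two elements have some at one index.\<close>
  have near_add: "\<exists>r'. near x (n + k) r'" if x: "x \<in> carrier P" "near x n r" for x n k r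
  proof (induction k)
    case (Suc k)
    then obtain r' where r': "r' \<in> carrier R" "x \<ominus>\<^bsub>P\<^esub> (m (n + k) \<cdot>\<^bsub>P\<^esub> r') \<in> Z"
      by (auto simp: near_def)
    have "(m (n + k) \<cdot>\<^bsub>P\<^esub> r') \<ominus>\<^bsub>P\<^esub> ((m (Suc (n + k)) \<cdot>\<^bsub>P\<^esub> a (n + k)) \<cdot>\<^bsub>P\<^esub> r') \<in> Z"
      using P.diff_submodule_rsmult[OF Z _ _ r'(1) chain] m a P.rsmult_closed by blast
    then have "x \<ominus>\<^bsub>P\<^esub> (m (Suc (n + k)) \<cdot>\<^bsub>P\<^esub> (a (n + k) \<otimes>\<^bsub>R\<^esub> r')) \<in> Z"
      using trans[OF x(1) _ _ r'(2)] r'(1) a m by (simp add: P.rsmult_closed P.rsmult_assoc)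
    then show ?case
      using r'(1) a by (auto simp: near_def intro!: exI[of _ "a (n + k) \<otimes>\<^bsub>R\<^esub> r'"])
  qed (use that in auto)
  have N: "right_submodule N R P"
  proof (rule P.right_submoduleI)
    show "\<zero>\<^bsub>P\<^esub> \<in> N"
      using refl[of "\<zero>\<^bsub>P\<^esub>"] P.rsmult_zero_right[OF m, of 0]
      by (auto simp: N_def near_def intro!: exI[of _ 0] exI[of _ "\<zero>\<^bsub>R\<^esub>"])
  next
    fix x y assume xy: "x \<in> N" "y \<in> N"
    then obtain i j r s where "near x i r" "near y j s" by (auto simp: N_def)
    then obtain r s where "near x (i + j) r" "near y (i + j) s"
      using near_add[of x i r j] near_add[of y j s i] xy by (auto simp: N_def add.commute)
    then have "near (x \<oplus>\<^bsub>P\<^esub> y) (i + j) (r \<oplus>\<^bsub>R\<^esub> s)"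
      using P.diff_submodule_add[OF Z, of x _ y] xy m
      by (auto simp: N_def near_def P.rsmult_add_ring P.rsmult_closed)
    then show "x \<oplus>\<^bsub>P\<^esub> y \<in> N" using xy by (auto simp: N_def)
  next
    fix x b assume xb: "x \<in> N" "b \<in> carrier R"
    then obtain i r where "near x i r" by (auto simp: N_def)
    then have "near (x \<cdot>\<^bsub>P\<^esub> b) i (r \<otimes>\<^bsub>R\<^esub> b)"
      using P.diff_submodule_rsmult[OF Z, of x _ b] xb m
      by (auto simp: N_def near_def P.rsmult_assoc P.rsmult_closed)
    then show "x \<cdot>\<^bsub>P\<^esub> b \<in> N" using xb by (auto simp: N_def P.rsmult_closed)
  qed (auto simp: N_def)
  obtain h :: "nat \<times> 'a \<Rightarrow> 'm" where h: "inj_on h (UNIV \<times> carrier R)"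
    using large by (auto simp: large_universe_def lepoll_def)
  \<comment> \<open>Equivalent elements satisfy the same predicate \<open>near\<close>, so the choice depends on the class only.\<close>
  define p where "p x = (SOME p. near x (fst p) (snd p))" for x
  have p: "near x (fst (p x)) (snd (p x))" if "x \<in> N" for x
    using that someI[of "\<lambda>p. near x (fst p) (snd p)"] by (force simp: N_def p_def)
  interpret Q: coset_map R P N Z "h \<circ> p"
  proof (intro coset_map.intro coset_map_axioms.intro P N Z iffI)
    fix x y assume x: "x \<in> N" and y: "y \<in> N"
    show "x \<ominus>\<^bsub>P\<^esub> y \<in> Z" if "(h \<circ> p) x = (h \<circ> p) y"
    proof -
      have "p x = p y"
        using that p[OF x] p[OF y] by (auto simp: near_def mem_Times_iff intro: inj_onD[OF h])
      then obtain n r where "near x n r" "near y n r" using p[OF x] p[OF y] by metis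
      then have r: "r \<in> carrier R" "x \<ominus>\<^bsub>P\<^esub> (m n \<cdot>\<^bsub>P\<^esub> r) \<in> Z" "y \<ominus>\<^bsub>P\<^esub> (m n \<cdot>\<^bsub>P\<^esub> r) \<in> Z"
        by (auto simp: near_def)
      note mr = P.rsmult_closed[OF m r(1), of n]
      show ?thesis
        by (rule trans[OF N_car[OF x] mr N_car[OF y] r(2)
              P.diff_submodule_sym[OF Z N_car[OF y] mr r(3)]])
    qed
    show "(h \<circ> p) x = (h \<circ> p) y" if xy: "x \<ominus>\<^bsub>P\<^esub> y \<in> Z"
    proof -
      note yx = P.diff_submodule_sym[OF Z N_car[OF x] N_car[OF y] xy]
      have "near x n r \<longleftrightarrow> near y n r" for n r
        using trans[OF N_car[OF x] N_car[OF y] _ xy] trans[OF N_car[OF y] N_car[OF x] _ yx]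
          P.rsmult_closed[OF m]
        unfolding near_def by blast
      then show ?thesis by (simp add: p_def)
    qed
  qed
  let ?q = "h \<circ> p" and ?M = "image_module P N (h \<circ> p)"
  interpret M: right_module R ?M by (rule Q.right_module_image)
  have mN: "m i \<in> N" for i
    using refl[OF m] P.rsmult_one[OF m, of i]
    by (auto simp: N_def near_def m intro!: exI[of _ i] exI[of _ "\<one>\<^bsub>R\<^esub>"])
  have "\<exists>n. \<exists>c\<in>carrier R. ?q (m (Suc n)) = ?q (m n) \<cdot>\<^bsub>?M\<^esub> c"
  proof (rule M.cyclic_chain_stationary[where a = a])
    show "regularly_weakly_based R ?M"
      using rwb Q.right_module_image by (simp add: all_right_modules_rwb_def)
    show "?q (m i) \<in> carrier ?M" for i using mN by simp
    show "a i \<in> carrier R" for i by (rule a)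
    show "?q (m i) = ?q (m (Suc i)) \<cdot>\<^bsub>?M\<^esub> a i" for i
      using Q.q_rsmult[OF mN a] Q.q_eq_iff[of "m i" "m (Suc i) \<cdot>\<^bsub>P\<^esub> a i"] chain mN
        P.right_submodule_rsmult[OF N mN a] by metis
    show "carrier ?M = (\<Union>i. Span R ?M {?q (m i)})"
    proof
      show "carrier ?M \<subseteq> (\<Union>i. Span R ?M {?q (m i)})"
      proof
        fix u assume "u \<in> carrier ?M"
        then obtain x where x: "x \<in> N" "u = ?q x" by auto
        then obtain n r where r: "r \<in> carrier R" "x \<ominus>\<^bsub>P\<^esub> (m n \<cdot>\<^bsub>P\<^esub> r) \<in> Z"
          by (auto simp: N_def near_def)
        then have "u = ?q (m n) \<cdot>\<^bsub>?M\<^esub> r"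
          using Q.q_rsmult[OF mN] Q.q_eq_iff x P.right_submodule_rsmult[OF N mN] by metis
        then show "u \<in> (\<Union>i. Span R ?M {?q (m i)})"
          using M.Span_singleton[of "?q (m n)"] mN r by auto
      qed
      show "(\<Union>i. Span R ?M {?q (m i)}) \<subseteq> carrier ?M"
        using mN by (intro UN_least M.Span_least M.right_submodule_carrier) auto
    qed
  qed
  then obtain n c where "c \<in> carrier R" "?q (m (Suc n)) = ?q (m n \<cdot>\<^bsub>P\<^esub> c)"
    using Q.q_rsmult[OF mN] by metis
  then show ?thesis
    using Q.q_eq_iff[OF mN P.right_submodule_rsmult[OF N mN]] by metis
qed

section \<open>Change of rings along the projection onto a quotient\<close>

definition inflate_module ::
    "('a, 'c) ring_scheme \<Rightarrow> 'a set \<Rightarrow> ('a set, 'm) right_module \<Rightarrow> ('a, 'm) right_module" where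
  "inflate_module R J M =
     \<lparr>carrier = carrier M, mult = mult M, one = one M, zero = zero M, add = add M,
      rsmult = (\<lambda>x a. x \<cdot>\<^bsub>M\<^esub> (J +>\<^bsub>R\<^esub> a))\<rparr>"

text \<open>On a module killed by \<open>J\<close>, all representatives of a coset act in the same way.\<close>

definition deflate_module ::
    "('a, 'm) right_module \<Rightarrow> ('a set, 'm) right_module" where
  "deflate_module M =
     \<lparr>carrier = carrier M, mult = mult M, one = one M, zero = zero M, add = add M,
      rsmult = (\<lambda>x A. x \<cdot>\<^bsub>M\<^esub> (SOME a. a \<in> A))\<rparr>"

lemma carrier_FactRing: "carrier (R Quot J) = (\<lambda>a. J +>\<^bsub>R\<^esub> a) ` carrier R"
  by (auto simp: FactRing_def A_RCOSETS_def RCOSETS_def a_r_coset_def)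

lemma zero_FactRing: "\<zero>\<^bsub>R Quot J\<^esub> = J"
  by (simp add: FactRing_def)

lemma all_right_modules_rwb_quotient:
  fixes R :: "('a, 'c) ring_scheme"
  assumes J: "ideal J R" and rwb: "all_right_modules_rwb TYPE('m) R"
  shows "all_right_modules_rwb TYPE('m) (R Quot J)"
  unfolding all_right_modules_rwb_def
proof (intro allI impI)
  fix M :: "('a set, 'm) right_module"
  assume "right_module (R Quot J) M"
  then interpret M: right_module "R Quot J" M .
  interpret J: ideal J R by (rule J)
  interpret pi: ring_hom_ring R "R Quot J" "\<lambda>a. J +>\<^bsub>R\<^esub> a" by (rule J.rcos_ring_hom_ring)
  let ?M = "inflate_module R J M"
  have "right_module R ?M"
    by (intro right_module.intro right_module_axioms.intro J.ring_axioms
        abelian_group_cong[OF M.M.abelian_group_axioms])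
      (simp_all add: inflate_module_def M.rsmult_closed M.rsmult_add_module M.rsmult_add_ring
        M.rsmult_assoc M.rsmult_one)
  then have "regularly_weakly_based R ?M" using rwb by (simp add: all_right_modules_rwb_def)
  moreover have "regularly_weakly_based R ?M \<longleftrightarrow> regularly_weakly_based (R Quot J) M"
  proof (rule regularly_weakly_based_cong)
    show same: "carrier ?M = carrier M" by (simp add: inflate_module_def)
    have "additive_subgroup N ?M \<longleftrightarrow> additive_subgroup N M" for N
      by (rule additive_subgroup_cong) (simp_all add: inflate_module_def)
    moreover have "x \<cdot>\<^bsub>?M\<^esub> a = x \<cdot>\<^bsub>M\<^esub> (J +>\<^bsub>R\<^esub> a)" for x a
      by (simp add: inflate_module_def)
    ultimately show "right_submodule N R ?M \<longleftrightarrow> right_submodule N (R Quot J) M" for N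
      by (simp add: right_submodule_def carrier_FactRing)
  qed
  ultimately show "regularly_weakly_based (R Quot J) M" by simp
qed

lemma regularly_weakly_based_deflate:
  fixes R :: "('a, 'c) ring_scheme" and M :: "('a, 'm) right_module"
  assumes J: "ideal J R" and M: "right_module R M"
    and kill: "\<And>x j. x \<in> carrier M \<Longrightarrow> j \<in> J \<Longrightarrow> x \<cdot>\<^bsub>M\<^esub> j = \<zero>\<^bsub>M\<^esub>"
    and rwb: "all_right_modules_rwb TYPE('m) (R Quot J)"
  shows "regularly_weakly_based R M"
proof -
  interpret M: right_module R M by (rule M)
  interpret J: ideal J R by (rule J)
  interpret pi: ring_hom_ring R "R Quot J" "\<lambda>a. J +>\<^bsub>R\<^esub> a" by (rule J.rcos_ring_hom_ring)
  let ?M = "deflate_module M"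
  have smult: "x \<cdot>\<^bsub>?M\<^esub> (J +>\<^bsub>R\<^esub> a) = x \<cdot>\<^bsub>M\<^esub> a" if x: "x \<in> carrier M" and a: "a \<in> carrier R" for x a
  proof -
    define b where "b = (SOME b. b \<in> J +>\<^bsub>R\<^esub> a)"
    have "b \<in> J +>\<^bsub>R\<^esub> a"
      unfolding b_def using J.a_rcos_self[OF a] by (rule someI)
    then obtain j where j: "j \<in> J" "b = j \<oplus>\<^bsub>R\<^esub> a" by (auto simp: a_r_coset_def')
    have "x \<cdot>\<^bsub>M\<^esub> b = x \<cdot>\<^bsub>M\<^esub> a"
      using j x a J.a_Hcarr kill[OF x j(1)] by (simp add: M.rsmult_add_ring M.rsmult_closed)
    then show ?thesis by (simp add: deflate_module_def b_def)
  qed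
  have same: "carrier ?M = carrier M" "add ?M = add M" "zero ?M = zero M"
    by (simp_all add: deflate_module_def)
  have "right_module (R Quot J) ?M"
    by (intro right_module.intro right_module_axioms.intro J.quotient_is_ring
        abelian_group_cong[OF M.M.abelian_group_axioms] same)
      (auto simp: same carrier_FactRing smult M.rsmult_closed M.rsmult_add_module
        M.rsmult_add_ring M.rsmult_assoc M.rsmult_one
        simp flip: pi.hom_add pi.hom_mult pi.hom_one)
  then have "regularly_weakly_based (R Quot J) ?M"
    using rwb by (simp add: all_right_modules_rwb_def)
  moreover have "right_submodule N R M \<longleftrightarrow> right_submodule N (R Quot J) ?M" for N
  proof -
    have "additive_subgroup N ?M \<longleftrightarrow> additive_subgroup N M"
      by (rule additive_subgroup_cong[OF same])
    moreover have "(\<forall>x\<in>N. \<forall>a\<in>carrier R. x \<cdot>\<^bsub>M\<^esub> a \<in> N) \<longleftrightarrow>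
        (\<forall>x\<in>N. \<forall>a\<in>carrier (R Quot J). x \<cdot>\<^bsub>?M\<^esub> a \<in> N)" if "additive_subgroup N M"
      using additive_subgroup.a_subset[OF that] by (auto simp: carrier_FactRing smult subset_iff)
    ultimately show ?thesis by (auto simp: right_submodule_def)
  qed
  ultimately show ?thesis
    using regularly_weakly_based_cong[of M ?M R "R Quot J"] same by simp
qed

section \<open>Right ideals and the Jacobson radical\<close>

context ring
begin

lemma right_idealI:
  assumes "I \<subseteq> carrier R" "\<zero> \<in> I" "\<And>x y. x \<in> I \<Longrightarrow> y \<in> I \<Longrightarrow> x \<oplus> y \<in> I"
    and "\<And>x a. x \<in> I \<Longrightarrow> a \<in> carrier R \<Longrightarrow> x \<otimes> a \<in> I"
  shows "right_ideal I R"
  using right_module.right_submoduleI[OF right_module_regular, of I] assms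
  by (simp add: right_ideal_def)

lemma
  assumes I: "right_ideal I R"
  shows right_ideal_subset: "I \<subseteq> carrier R"
    and right_ideal_zero: "\<zero> \<in> I"
    and right_ideal_add: "x \<in> I \<Longrightarrow> y \<in> I \<Longrightarrow> x \<oplus> y \<in> I"
    and right_ideal_diff: "x \<in> I \<Longrightarrow> y \<in> I \<Longrightarrow> x \<ominus> y \<in> I"
    and right_ideal_mult: "x \<in> I \<Longrightarrow> a \<in> carrier R \<Longrightarrow> x \<otimes> a \<in> I"
proof -
  interpret M: right_module R "regular_right_module R" by (rule right_module_regular)
  note I' = I[unfolded right_ideal_def]
  show "I \<subseteq> carrier R" "\<zero> \<in> I" "x \<in> I \<Longrightarrow> y \<in> I \<Longrightarrow> x \<oplus> y \<in> I"
    "x \<in> I \<Longrightarrow> y \<in> I \<Longrightarrow> x \<ominus> y \<in> I" "x \<in> I \<Longrightarrow> a \<in> carrier R \<Longrightarrow> x \<otimes> a \<in> I"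
    using M.right_submodule_subset[OF I'] M.right_submodule_zero[OF I']
      M.right_submodule_add[OF I'] M.right_submodule_diff[OF I']
      M.right_submodule_rsmult[OF I'] by simp_all
qed

lemma right_ideal_multiples: "x \<in> carrier R \<Longrightarrow> right_ideal ((\<lambda>a. x \<otimes> a) ` carrier R) R"
  using right_module.right_submodule_multiples[OF right_module_regular]
  by (simp add: right_ideal_def)

lemma right_ideal_eq_carrier_iff:
  assumes "right_ideal I R"
  shows "I = carrier R \<longleftrightarrow> \<one> \<in> I"
proof
  assume one: "\<one> \<in> I"
  have "a \<in> I" if "a \<in> carrier R" for a
    using right_ideal_mult[OF assms one that] that by simp
  then show "I = carrier R" using right_ideal_subset[OF assms] by blast
qed auto

lemma maximal_right_ideal_exists:
  assumes I: "right_ideal I R" and one: "\<one> \<notin> I"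
  shows "\<exists>K. maximal_right_ideal K R \<and> I \<subseteq> K"
proof -
  let ?A = "{K. right_ideal K R \<and> I \<subseteq> K \<and> \<one> \<notin> K}"
  have "\<exists>K\<in>?A. \<forall>L\<in>?A. K \<subseteq> L \<longrightarrow> L = K"
  proof (rule subset_Zorn_nonempty)
    show "?A \<noteq> {}" using I one by blast
    fix \<C> assume ne: "\<C> \<noteq> {}" and chain: "subset.chain ?A \<C>"
    have mem: "right_ideal K R" "I \<subseteq> K" "\<one> \<notin> K" if "K \<in> \<C>" for K
      using chain that by (auto simp: subset.chain_def)
    have "right_ideal (\<Union>\<C>) R"
    proof (rule right_idealI)
      fix x y assume "x \<in> \<Union>\<C>" "y \<in> \<Union>\<C>"
      then obtain K L where KL: "K \<in> \<C>" "x \<in> K" "L \<in> \<C>" "y \<in> L" by blast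
      then have "K \<subseteq> L \<or> L \<subseteq> K" using chain by (auto simp: subset_chain_def)
      then obtain K' where K': "K' \<in> \<C>" "x \<in> K'" "y \<in> K'" using KL by blast
      then have "x \<oplus> y \<in> K'" using right_ideal_add[OF mem(1)] by blast
      then show "x \<oplus> y \<in> \<Union>\<C>" using K' by blast
    next
      show "\<Union>\<C> \<subseteq> carrier R" using right_ideal_subset[OF mem(1)] by blast
      obtain K where "K \<in> \<C>" using ne by blast
      then show "\<zero> \<in> \<Union>\<C>" using right_ideal_zero[OF mem(1)] by blast
    next
      fix x a assume "x \<in> \<Union>\<C>" "a \<in> carrier R"
      then obtain K where "K \<in> \<C>" "x \<in> K" "a \<in> carrier R" by blast
      then show "x \<otimes> a \<in> \<Union>\<C>" using right_ideal_mult[OF mem(1)] by blast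
    qed
    then show "\<Union>\<C> \<in> ?A" using ne mem by blast
  qed
  then obtain K where K: "K \<in> ?A" and max: "\<forall>L\<in>?A. K \<subseteq> L \<longrightarrow> L = K" by (rule bexE)
  have "L = K \<or> L = carrier R" if L: "right_ideal L R" "K \<subseteq> L" for L
  proof (cases "\<one> \<in> L")
    case True
    then show ?thesis using right_ideal_eq_carrier_iff[OF L(1)] by simp
  next
    case False
    then have "L \<in> ?A" using K L by auto
    then show ?thesis using max L(2) by simp
  qed
  moreover have "K \<noteq> carrier R" using K by auto
  ultimately have "maximal_right_ideal K R" using K by (simp add: maximal_right_ideal_def)
  then show ?thesis using K by blast
qed

lemma maximal_right_ideal_not_one:
  assumes "maximal_right_ideal K R"
  shows "right_ideal K R" "\<one> \<notin> K"
  using assms right_ideal_eq_carrier_iff by (auto simp: maximal_right_ideal_def)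

lemma maximal_right_ideal_comaximal:
  assumes K: "maximal_right_ideal K R" and x: "x \<in> carrier R" "x \<notin> K"
  shows "\<exists>r\<in>carrier R. \<exists>k\<in>K. (x \<otimes> r) \<oplus> k = \<one>"
proof -
  note K' = maximal_right_ideal_not_one(1)[OF K]
  have Kc: "k \<in> K \<Longrightarrow> k \<in> carrier R" for k using right_ideal_subset[OF K'] by blast
  let ?L = "{(x \<otimes> r) \<oplus> k | r k. r \<in> carrier R \<and> k \<in> K}"
  have "right_ideal ?L R"
  proof (rule right_idealI)
    show "?L \<subseteq> carrier R" using x Kc by auto
    show "\<zero> \<in> ?L"
      using x right_ideal_zero[OF K'] by (auto intro!: exI[of _ \<zero>])
  next
    fix u v assume "u \<in> ?L" "v \<in> ?L"
    then obtain r k s l where *: "r \<in> carrier R" "k \<in> K" "s \<in> carrier R" "l \<in> K"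
      "u = (x \<otimes> r) \<oplus> k" "v = (x \<otimes> s) \<oplus> l" by blast
    then have "u \<oplus> v = (x \<otimes> (r \<oplus> s)) \<oplus> (k \<oplus> l)"
      using x Kc by (simp add: r_distr a_ac)
    then show "u \<oplus> v \<in> ?L" using * right_ideal_add[OF K'] by blast
  next
    fix u a assume "u \<in> ?L" and a: "a \<in> carrier R"
    then obtain r k where *: "r \<in> carrier R" "k \<in> K" "u = (x \<otimes> r) \<oplus> k" by blast
    then have "u \<otimes> a = (x \<otimes> (r \<otimes> a)) \<oplus> (k \<otimes> a)"
      using x Kc a by (simp add: l_distr m_assoc)
    then show "u \<otimes> a \<in> ?L" using * a right_ideal_mult[OF K'] by blast
  qed
  moreover have "K \<subseteq> ?L"
  proof
    fix k assume k: "k \<in> K"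
    then have "k = (x \<otimes> \<zero>) \<oplus> k" using x Kc by simp
    then show "k \<in> ?L" using k by blast
  qed
  moreover have "x \<in> ?L"
  proof -
    have "x = (x \<otimes> \<one>) \<oplus> \<zero>" using x by simp
    then show ?thesis using right_ideal_zero[OF K'] by blast
  qed
  moreover have "L = carrier R" if "right_ideal L R" "K \<subseteq> L" "x \<in> L" for L
    using K x(2) that unfolding maximal_right_ideal_def by blast
  ultimately have "?L = carrier R" by blast
  then have "\<one> \<in> ?L" by simp
  then show ?thesis by force
qed

lemma jacobson_radical_subset_maximal:
  "maximal_right_ideal K R \<Longrightarrow> jacobson_radical R \<subseteq> K"
  unfolding jacobson_radical_def by blast

lemma right_ideal_jacobson_radical: "right_ideal (jacobson_radical R) R"
proof (rule right_idealI)
  note max = maximal_right_ideal_not_one(1)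
  show "jacobson_radical R \<subseteq> carrier R" by (simp add: jacobson_radical_def)
  show "\<zero> \<in> jacobson_radical R"
    using right_ideal_zero[OF max] by (simp add: jacobson_radical_def)
  show "x \<oplus> y \<in> jacobson_radical R" if "x \<in> jacobson_radical R" "y \<in> jacobson_radical R" for x y
    using right_ideal_add[OF max] that by (simp add: jacobson_radical_def)
  show "x \<otimes> a \<in> jacobson_radical R" if "x \<in> jacobson_radical R" "a \<in> carrier R" for x a
    using right_ideal_mult[OF max] that by (simp add: jacobson_radical_def)
qed

text \<open>
  If \<open>r \<otimes> j\<close> lies outside a maximal right ideal \<open>K\<close>, then \<open>{x. r \<otimes> x \<in> K}\<close> is a maximal right
  ideal that \<open>j\<close> avoids; so the radical is closed under multiplication from the left.
\<close>

lemma ideal_jacobson_radical: "ideal (jacobson_radical R) R"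
proof (rule idealI)
  show "ring R" by (rule ring_axioms)
  show "subgroup (jacobson_radical R) (add_monoid R)"
    using right_ideal_jacobson_radical additive_subgroup_cong[of "regular_right_module R" R]
    by (simp add: right_ideal_def right_submodule_def additive_subgroup_def)
  show "j \<otimes> r \<in> jacobson_radical R" if "j \<in> jacobson_radical R" "r \<in> carrier R" for j r
    using right_ideal_mult[OF right_ideal_jacobson_radical] that by blast
  fix j r assume j: "j \<in> jacobson_radical R" and r: "r \<in> carrier R"
  have jc: "j \<in> carrier R" using j by (simp add: jacobson_radical_def)
  have "r \<otimes> j \<in> K" if K: "maximal_right_ideal K R" for K
  proof (rule ccontr)
    assume rj: "r \<otimes> j \<notin> K"
    note K' = maximal_right_ideal_not_one[OF K]
    define C where "C = {x \<in> carrier R. r \<otimes> x \<in> K}"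
    have C: "right_ideal C R"
    proof (rule right_idealI)
      show "\<zero> \<in> C" using r right_ideal_zero[OF K'(1)] by (simp add: C_def)
      show "x \<oplus> y \<in> C" if "x \<in> C" "y \<in> C" for x y
        using that r right_ideal_add[OF K'(1), of "r \<otimes> x" "r \<otimes> y"] by (simp add: C_def r_distr)
      show "x \<otimes> a \<in> C" if "x \<in> C" "a \<in> carrier R" for x a
        using that r right_ideal_mult[OF K'(1), of "r \<otimes> x" a] by (simp add: C_def m_assoc)
    qed (auto simp: C_def)
    have "r \<notin> K" using rj right_ideal_mult[OF K'(1)] jc by blast
    then have "\<one> \<notin> C" using r by (simp add: C_def)
    then have oneC: "C \<noteq> carrier R" using one_closed by blast
    have "L = C \<or> L = carrier R" if L: "right_ideal L R" "C \<subseteq> L" for L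
    proof (cases "L \<subseteq> C")
      case False
      then obtain x where x: "x \<in> L" "x \<in> carrier R" "r \<otimes> x \<notin> K"
        using right_ideal_subset[OF L(1)] unfolding C_def by blast
      then obtain s k where s: "s \<in> carrier R" "k \<in> K" "(r \<otimes> x \<otimes> s) \<oplus> k = \<one>"
        using maximal_right_ideal_comaximal[OF K, of "r \<otimes> x"] r by auto
      have kc: "k \<in> carrier R" using s right_ideal_subset[OF K'(1)] by blast
      have "((r \<otimes> x \<otimes> s) \<oplus> k) \<ominus> (r \<otimes> x \<otimes> s) = k"
        using s(1) kc r x a_comm[of "r \<otimes> x \<otimes> s" k] by (simp add: minus_eq a_assoc r_neg)
      then have k: "k = \<one> \<ominus> (r \<otimes> x \<otimes> s)" by (simp add: s(3))
      have "k \<otimes> r = r \<otimes> (\<one> \<ominus> (x \<otimes> s \<otimes> r))"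
        using r x s by (simp add: k minus_eq l_distr r_distr l_minus r_minus m_assoc)
      moreover have "k \<otimes> r \<in> K" using right_ideal_mult[OF K'(1)] s r by blast
      ultimately have "\<one> \<ominus> (x \<otimes> s \<otimes> r) \<in> C" using r x s by (simp add: C_def)
      then have "\<one> \<ominus> (x \<otimes> s \<otimes> r) \<in> L" using L(2) by blast
      moreover have "x \<otimes> s \<otimes> r \<in> L" using right_ideal_mult[OF L(1)] x s r by blast
      ultimately have "(\<one> \<ominus> (x \<otimes> s \<otimes> r)) \<oplus> (x \<otimes> s \<otimes> r) \<in> L" using right_ideal_add[OF L(1)] by blast
      then have "\<one> \<in> L" using r x s by (simp add: minus_eq a_assoc l_neg)
      then show ?thesis using right_ideal_eq_carrier_iff[OF L(1)] by blast
    qed (use L in blast)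
    then have "maximal_right_ideal C R"
      using C oneC unfolding maximal_right_ideal_def by blast
    then have "j \<in> C" using j unfolding jacobson_radical_def by blast
    then show False using rj unfolding C_def by blast
  qed
  then show "r \<otimes> j \<in> jacobson_radical R" using r jc by (simp add: jacobson_radical_def)
qed

lemma one_minus_radical_right_invertible:
  assumes j: "j \<in> jacobson_radical R"
  shows "\<exists>c\<in>carrier R. (\<one> \<ominus> j) \<otimes> c = \<one>"
proof (rule ccontr)
  assume no: "\<not> ?thesis"
  have jc: "j \<in> carrier R" using j by (simp add: jacobson_radical_def)
  let ?I = "(\<lambda>a. (\<one> \<ominus> j) \<otimes> a) ` carrier R"
  have "right_ideal ?I R" using jc by (intro right_ideal_multiples) auto
  moreover have "\<one> \<notin> ?I" using no unfolding image_iff by metis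
  ultimately obtain K where K: "maximal_right_ideal K R" "?I \<subseteq> K"
    using maximal_right_ideal_exists[of ?I] by blast
  note K' = maximal_right_ideal_not_one[OF K(1)]
  have "\<one> \<ominus> j \<in> ?I" by (rule image_eqI[of _ _ \<one>]) (use jc in auto)
  then have "\<one> \<ominus> j \<in> K" using K by blast
  moreover have "j \<in> K" using j jacobson_radical_subset_maximal[OF K(1)] by blast
  ultimately have "(\<one> \<ominus> j) \<oplus> j \<in> K" by (rule right_ideal_add[OF K'(1)])
  then show False using K'(2) jc by (simp add: minus_eq a_assoc l_neg)
qed

text \<open>
  Modulo a maximal right ideal that avoids \<open>x\<close>, some multiple \<open>x \<otimes> r\<close> is congruent to
  \<open>\<one>\<close>, and so are its powers.
\<close>

lemma not_nil_modulo_radical: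
  assumes x: "x \<in> carrier R" "x \<notin> jacobson_radical R"
  shows "\<exists>r\<in>carrier R. \<forall>n::nat. (x \<otimes> r) [^] n \<notin> jacobson_radical R"
proof -
  obtain K where K: "maximal_right_ideal K R" "x \<notin> K"
    using x unfolding jacobson_radical_def by blast
  note K' = maximal_right_ideal_not_one[OF K(1)]
  obtain r k where r: "r \<in> carrier R" "k \<in> K" "(x \<otimes> r) \<oplus> k = \<one>"
    using maximal_right_ideal_comaximal[OF K(1) x(1) K(2)] by blast
  define b where "b = x \<otimes> r"
  have b: "b \<in> carrier R" using x r by (simp add: b_def)
  have "k \<in> carrier R" using r right_ideal_subset[OF K'(1)] by blast
  then have "(b \<oplus> k) \<ominus> b = k" using b a_comm[of b k] by (simp add: minus_eq a_assoc r_neg)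
  then have k: "\<one> \<ominus> b = k" using r(3) by (simp add: b_def)
  have pow: "\<one> \<ominus> b [^] n \<in> K" for n :: nat
  proof (induction n)
    case 0
    then show ?case using right_ideal_zero[OF K'(1)] by (simp add: minus_eq r_neg)
  next
    case (Suc n)
    have "\<one> \<ominus> b [^] Suc n = (\<one> \<ominus> b) \<oplus> ((\<one> \<ominus> b [^] n) \<otimes> b)"
      using b nat_pow_closed[OF b, of n] by (simp add: minus_eq l_distr l_minus a_assoc r_neg1)
    then show ?case
      using right_ideal_add[OF K'(1)] right_ideal_mult[OF K'(1) Suc b] k r(2) by simp
  qed
  have "b [^] n \<notin> jacobson_radical R" for n :: nat
  proof
    assume "b [^] n \<in> jacobson_radical R"
    then have "b [^] n \<in> K" using jacobson_radical_subset_maximal[OF K(1)] by blast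
    with pow[of n] have "(\<one> \<ominus> b [^] n) \<oplus> b [^] n \<in> K" by (rule right_ideal_add[OF K'(1)])
    then show False using K'(2) b by (simp add: minus_eq a_assoc l_neg)
  qed
  then show ?thesis using r(1) by (auto simp: b_def)
qed

end

section \<open>Chain conditions on rings over which all modules are regularly weakly based\<close>

definition sequence_module :: "('a, 'c) ring_scheme \<Rightarrow> ('a, nat \<Rightarrow> 'a) right_module" where
  "sequence_module R =
     \<lparr>carrier = {s. \<forall>i. s i \<in> carrier R}, mult = (\<lambda>s t i. s i \<otimes>\<^bsub>R\<^esub> t i), one = (\<lambda>_. \<one>\<^bsub>R\<^esub>),
      zero = (\<lambda>_. \<zero>\<^bsub>R\<^esub>), add = (\<lambda>s t i. s i \<oplus>\<^bsub>R\<^esub> t i), rsmult = (\<lambda>s a i. s i \<otimes>\<^bsub>R\<^esub> a)\<rparr>"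

lemma sequence_module_simps [simp]:
  "carrier (sequence_module R) = {s. \<forall>i. s i \<in> carrier R}"
  "\<zero>\<^bsub>sequence_module R\<^esub> = (\<lambda>_. \<zero>\<^bsub>R\<^esub>)"
  "s \<oplus>\<^bsub>sequence_module R\<^esub> t = (\<lambda>i. s i \<oplus>\<^bsub>R\<^esub> t i)"
  "s \<cdot>\<^bsub>sequence_module R\<^esub> a = (\<lambda>i. s i \<otimes>\<^bsub>R\<^esub> a)"
  by (simp_all add: sequence_module_def)

context ring
begin

lemma right_module_sequence: "right_module R (sequence_module R)"
proof (intro right_module.intro right_module_axioms.intro ring_axioms)
  show "abelian_group (sequence_module R)"
  proof (rule abelian_groupI)
    fix s assume "s \<in> carrier (sequence_module R)"
    then show "\<exists>t\<in>carrier (sequence_module R).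
        t \<oplus>\<^bsub>sequence_module R\<^esub> s = \<zero>\<^bsub>sequence_module R\<^esub>"
      by (intro bexI[of _ "\<lambda>i. \<ominus> s i"]) (auto simp: l_neg)
  qed (auto simp: a_ac)
qed (auto simp: l_distr r_distr m_assoc)

lemma minus_sequence:
  assumes "s \<in> carrier (sequence_module R)" "t \<in> carrier (sequence_module R)"
  shows "s \<ominus>\<^bsub>sequence_module R\<^esub> t = (\<lambda>i. s i \<ominus> t i)"
proof -
  interpret S: right_module R "sequence_module R" by (rule right_module_sequence)
  have "\<ominus>\<^bsub>sequence_module R\<^esub> t = (\<lambda>i. \<ominus> t i)"
    using S.M.minus_equality[of "\<lambda>i. \<ominus> t i" t] assms by (simp add: l_neg)
  then show ?thesis by (simp add: minus_eq S.M.minus_eq)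
qed

lemma rev_prod_closed: "(\<And>i. a i \<in> carrier R) \<Longrightarrow> rev_prod R a n \<in> carrier R"
  by (induction n) auto

lemma rev_prod_add:
  "(\<And>i. a i \<in> carrier R) \<Longrightarrow>
    rev_prod R a (n + k) = rev_prod R (\<lambda>j. a (n + j)) k \<otimes> rev_prod R a n"
  by (induction k) (auto simp: rev_prod_closed m_assoc)

lemma rev_prod_Suc_right:
  assumes "\<And>i. a i \<in> carrier R"
  shows "rev_prod R a (Suc k) = rev_prod R (\<lambda>j. a (Suc j)) k \<otimes> a 1"
  using rev_prod_add[of a 1 k] assms by simp

lemma rev_prod_const: "b \<in> carrier R \<Longrightarrow> rev_prod R (\<lambda>_. b) n = b [^] n"
proof (induction n)
  case (Suc n)
  then show ?case using nat_pow_Suc2[of b n] by simp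
qed simp

text \<open>
  This is the chain condition in the direct limit of the sequence \<open>R \<rightarrow> R \<rightarrow> \<dots>\<close> whose maps are the
  left multiplications by \<open>a 1, a 2, \<dots>\<close>.  The limit is realized by sequences modulo those that
  vanish eventually; the image of the unit of the \<open>n\<close>-th copy of \<open>R\<close> is the sequence of the
  products \<open>a i \<otimes> \<dots> \<otimes> a (n + 1)\<close>.
\<close>

lemma rev_prod_tail_divisible:
  assumes large: "large_universe TYPE('m) R" and rwb: "all_right_modules_rwb TYPE('m) R"
    and a: "\<And>i. a i \<in> carrier R"
  shows "\<exists>n k. \<exists>c\<in>carrier R.
    rev_prod R (\<lambda>j. a (Suc n + j)) k = rev_prod R (\<lambda>j. a (n + j)) (Suc k) \<otimes> c"
proof -
  interpret S: right_module R "sequence_module R" by (rule right_module_sequence)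
  define m where "m n i = rev_prod R (\<lambda>j. a (n + j)) (i - n)" for n i
  have m: "m n i \<in> carrier R" for n i by (simp add: m_def rev_prod_closed a)
  let ?Z = "{s \<in> carrier (sequence_module R). \<exists>k. \<forall>i\<ge>k. s i = \<zero>}"
  have "\<exists>n. \<exists>c\<in>carrier R. m (Suc n) \<ominus>\<^bsub>sequence_module R\<^esub> (m n \<cdot>\<^bsub>sequence_module R\<^esub> c) \<in> ?Z"
  proof (rule chain_stationary_modulo_submodule[OF right_module_sequence _ large rwb,
        where a = "\<lambda>i. a (Suc i)"])
    show "right_submodule ?Z R (sequence_module R)"
    proof (rule S.right_submoduleI)
      fix s t assume "s \<in> ?Z" "t \<in> ?Z"
      then obtain k l where "\<forall>i\<ge>k. s i = \<zero>" "\<forall>i\<ge>l. t i = \<zero>"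
        "s \<in> carrier (sequence_module R)" "t \<in> carrier (sequence_module R)" by blast
      then show "s \<oplus>\<^bsub>sequence_module R\<^esub> t \<in> ?Z" by (auto intro!: exI[of _ "max k l"])
    next
      fix s b assume "s \<in> ?Z" "b \<in> carrier R"
      then show "s \<cdot>\<^bsub>sequence_module R\<^esub> b \<in> ?Z" by fastforce
    qed auto
    show "m n \<ominus>\<^bsub>sequence_module R\<^esub> (m (Suc n) \<cdot>\<^bsub>sequence_module R\<^esub> a (Suc n)) \<in> ?Z" for n
    proof -
      have "m n i = m (Suc n) i \<otimes> a (Suc n)" if "Suc n \<le> i" for i
      proof -
        obtain k where k: "i = Suc n + k" using le_Suc_ex[OF \<open>Suc n \<le> i\<close>] by (rule exE)
        show ?thesis
          using rev_prod_Suc_right[of "\<lambda>j. a (n + j)" k] a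
          by (simp add: m_def k del: rev_prod.simps)
      qed
      then show ?thesis
        using m a by (auto simp: minus_sequence minus_eq r_neg intro!: exI[of _ "Suc n"])
    qed
  qed (use a m in auto)
  then obtain n c k where c: "c \<in> carrier R" "\<And>i. k \<le> i \<Longrightarrow> m (Suc n) i \<ominus> (m n i \<otimes> c) = \<zero>"
    using m by (auto simp: minus_sequence)
  have "m (Suc n) (Suc n + k) = m n (Suc n + k) \<otimes> c"
    using c(2)[of "Suc n + k"] c(1) m by simp
  then show ?thesis using c(1) by (auto simp: m_def simp del: rev_prod.simps)
qed

text \<open>
  If \<open>p = p \<otimes> (a (n + 1) \<otimes> c)\<close> for a product \<open>p = a k \<otimes> \<dots> \<otimes> a (n + 2)\<close> of elements of the radical, then
  \<open>p = \<zero>\<close>, because \<open>\<one> \<ominus> a (n + 1) \<otimes> c\<close> is right invertible.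
\<close>

lemma radical_right_T_nilpotent:
  assumes large: "large_universe TYPE('m) R" and rwb: "all_right_modules_rwb TYPE('m) R"
  shows "right_T_nilpotent R (jacobson_radical R)"
  unfolding right_T_nilpotent_def
proof (intro allI impI)
  fix a :: "nat \<Rightarrow> 'a" assume a: "\<forall>i\<ge>1. a i \<in> jacobson_radical R"
  \<comment> \<open>The entry \<open>a 0\<close> is arbitrary, so it is replaced by an element of the ring.\<close>
  define a' where "a' i = (if i = 0 then \<zero> else a i)" for i
  have J: "a' i \<in> jacobson_radical R" for i
    using a right_ideal_zero[OF right_ideal_jacobson_radical] by (auto simp: a'_def)
  then have car: "a' i \<in> carrier R" for i by (auto simp: jacobson_radical_def)
  have same: "rev_prod R a n = rev_prod R a' n" for n by (induction n) (auto simp: a'_def)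
  obtain n k c where c: "c \<in> carrier R"
    "rev_prod R (\<lambda>j. a' (Suc n + j)) k = rev_prod R (\<lambda>j. a' (n + j)) (Suc k) \<otimes> c"
    using rev_prod_tail_divisible[OF large rwb, of a'] car by auto
  define p where "p = rev_prod R (\<lambda>j. a' (Suc n + j)) k"
  have p: "p \<in> carrier R" by (simp add: p_def rev_prod_closed car)
  define j where "j = a' (Suc n) \<otimes> c"
  have j: "j \<in> carrier R" using car c by (simp add: j_def)
  have "rev_prod R (\<lambda>j. a' (n + j)) (Suc k) = p \<otimes> a' (Suc n)"
    using rev_prod_Suc_right[of "\<lambda>j. a' (n + j)" k] car by (simp add: p_def del: rev_prod.simps)
  then have "p \<otimes> a' (Suc n) \<otimes> c = p" using c(2) by (simp only: p_def)
  then have "p \<otimes> j = p" using c(1) p car by (simp add: j_def m_assoc)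
  then have "p \<otimes> (\<one> \<ominus> j) = \<zero>" using p j by (simp add: minus_eq r_distr r_minus r_neg)
  moreover obtain d where d: "d \<in> carrier R" "(\<one> \<ominus> j) \<otimes> d = \<one>"
    using one_minus_radical_right_invertible[of j]
      right_ideal_mult[OF right_ideal_jacobson_radical J c(1)] by (auto simp: j_def)
  ultimately have "p = \<zero>"
    using m_assoc[of p "\<one> \<ominus> j" d] p j by simp
  then have "rev_prod R a' (Suc n + k) = \<zero>"
    using rev_prod_add[of a' "Suc n" k] car by (simp add: p_def rev_prod_closed del: rev_prod.simps)
  then show "\<exists>n\<ge>1. rev_prod R a n = \<zero>" by (intro exI[of _ "Suc n + k"]) (simp add: same del: rev_prod.simps)
qed

lemma power_divisible:
  assumes large: "large_universe TYPE('m) R" and rwb: "all_right_modules_rwb TYPE('m) R"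
    and b: "b \<in> carrier R"
  shows "\<exists>k::nat. \<exists>c\<in>carrier R. b [^] k = b [^] Suc k \<otimes> c"
proof -
  obtain k c where "c \<in> carrier R" "rev_prod R (\<lambda>_. b) k = rev_prod R (\<lambda>_. b) (Suc k) \<otimes> c"
    using rev_prod_tail_divisible[OF large rwb, of "\<lambda>_. b"] b by auto
  then show ?thesis unfolding rev_prod_const[OF b] by blast
qed

lemma principal_right_ideal_chain_stationary:
  assumes large: "large_universe TYPE('m) R" and rwb: "all_right_modules_rwb TYPE('m) R"
    and m: "\<And>i. m i \<in> carrier R" and chain: "\<And>i. \<exists>a\<in>carrier R. m i = m (Suc i) \<otimes> a"
  shows "\<exists>n. \<exists>c\<in>carrier R. m (Suc n) = m n \<otimes> c"
proof -
  interpret M: right_module R "regular_right_module R" by (rule right_module_regular)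
  obtain a where a: "\<And>i. a i \<in> carrier R" "\<And>i. m i = m (Suc i) \<otimes> a i"
    using chain by metis
  have "\<exists>n. \<exists>c\<in>carrier R.
      m (Suc n) \<ominus>\<^bsub>regular_right_module R\<^esub> (m n \<cdot>\<^bsub>regular_right_module R\<^esub> c) \<in> {\<zero>}"
  proof (rule chain_stationary_modulo_submodule[OF right_module_regular _ large rwb, where a = a])
    show "right_submodule {\<zero>} R (regular_right_module R)"
      using M.right_submodule_zero_set by simp
    show "m i \<ominus>\<^bsub>regular_right_module R\<^esub> (m (Suc i) \<cdot>\<^bsub>regular_right_module R\<^esub> a i) \<in> {\<zero>}" for i
      using a(1)[of i] m by (simp add: minus_eq r_neg flip: a(2))
  qed (use m a(1) in auto)
  then show ?thesis using m by auto
qed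

section \<open>Idempotents and semisimplicity\<close>

text \<open>
  Some power \<open>B\<close> of \<open>b\<close> satisfies \<open>B = B\<^sup>2 C\<close>, and the elements \<open>\<one> \<ominus> C\<^sup>j B\<^sup>j\<close> generate an ascending chain of principal right ideals.
  Where the chain stops, such an element is idempotent, hence so is \<open>f = C\<^sup>j B\<^sup>j\<close>.
  As \<open>B\<^sup>j\<^sup>+\<^sup>1 f = B\<^sup>j\<^sup>+\<^sup>1\<close> and \<open>b\<close> is not nilpotent, \<open>f \<noteq> \<zero>\<close>.  The factors are then exchanged:
  \<open>B\<^sup>j f C\<^sup>j\<close> is a nonzero idempotent in the right ideal of \<open>b\<close>.
\<close>

lemma idempotent_multiple_exists:
  assumes acc: "\<And>m. (\<And>i. m i \<in> carrier R) \<Longrightarrow> (\<And>i. \<exists>a\<in>carrier R. m i = m (Suc i) \<otimes> a) \<Longrightarrow>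
      \<exists>n. \<exists>c\<in>carrier R. m (Suc n) = m n \<otimes> c"
    and b: "b \<in> carrier R" and not_nil: "\<And>n::nat. b [^] n \<noteq> \<zero>"
    and c: "c \<in> carrier R" "b [^] (k::nat) = b [^] Suc k \<otimes> c"
  shows "\<exists>r\<in>carrier R. b \<otimes> r \<noteq> \<zero> \<and> (b \<otimes> r) \<otimes> (b \<otimes> r) = b \<otimes> r"
proof -
  \<comment> \<open>The exponent is made positive, so that the powers of \<open>B = b\<^sup>n\<close> are right multiples of \<open>b\<close>.\<close>
  define n where "n = Suc k"
  have "b [^] n = b \<otimes> b [^] k" by (simp only: n_def nat_pow_Suc2[OF b])
  also have "\<dots> = b \<otimes> (b [^] Suc k \<otimes> c)" by (simp only: c(2)[symmetric])
  also have "\<dots> = (b \<otimes> b [^] Suc k) \<otimes> c" using b c(1) by (simp add: m_assoc del: nat_pow_Suc)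
  also have "b \<otimes> b [^] Suc k = b [^] Suc n" by (simp only: n_def nat_pow_Suc2[OF b])
  finally have step: "b [^] n = b [^] Suc n \<otimes> c" .
  have step_pow: "b [^] n = b [^] (n + i) \<otimes> c [^] i" for i :: nat
  proof (induction i)
    case (Suc i)
    have "b [^] (n + Suc i) \<otimes> c [^] Suc i = (b [^] i \<otimes> b [^] Suc n) \<otimes> (c \<otimes> c [^] i)"
      using b c(1) nat_pow_Suc2[OF c(1)] nat_pow_mult[OF b, of i "Suc n"]
      by (simp add: add.commute del: nat_pow_Suc)
    also have "\<dots> = b [^] i \<otimes> (b [^] Suc n \<otimes> c) \<otimes> c [^] i"
      using b c(1) by (simp add: m_assoc del: nat_pow_Suc)
    also have "\<dots> = b [^] (n + i) \<otimes> c [^] i"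
      unfolding step[symmetric] using nat_pow_mult[OF b, of i n] by (simp add: add.commute)
    finally show ?case using Suc by simp
  qed (use b in simp)
  define B C where "B = b [^] n" and "C = c [^] n"
  have B: "B \<in> carrier R" and C: "C \<in> carrier R" using b c by (simp_all add: B_def C_def)
  note BC = B C nat_pow_closed[OF B] nat_pow_closed[OF C]
  have BBC: "B = B [^] Suc j \<otimes> C [^] j" for j :: nat
    using step_pow[of "n * j"] nat_pow_pow[OF b, of n "Suc j"] nat_pow_pow[OF c(1), of n j]
    by (simp add: B_def C_def del: nat_pow_Suc)
  define F where "F j = C [^] j \<otimes> B [^] j" for j :: nat
  have F: "F j \<in> carrier R" for j by (simp add: F_def BC)
  have BF: "B [^] Suc j \<otimes> F j = B [^] Suc j" for j
  proof -
    have "B [^] Suc j \<otimes> F j = (B [^] Suc j \<otimes> C [^] j) \<otimes> B [^] j"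
      by (simp add: F_def BC m_assoc del: nat_pow_Suc)
    also have "\<dots> = B [^] Suc j" using BBC[of j] nat_pow_Suc2[OF B] by simp
    finally show ?thesis .
  qed
  define e where "e j = \<one> \<ominus> F j" for j
  have e: "e j \<in> carrier R" for j by (simp add: e_def F)
  have "F (Suc j) \<otimes> e j = \<zero>" for j
  proof -
    have "F (Suc j) \<otimes> e j = C [^] Suc j \<otimes> (B [^] Suc j \<ominus> B [^] Suc j \<otimes> F j)"
      using e F by (simp add: F_def[of "Suc j"] e_def BC m_assoc r_distr r_minus minus_eq
          del: nat_pow_Suc)
    also have "\<dots> = \<zero>" unfolding BF by (simp add: BC minus_eq r_neg del: nat_pow_Suc)
    finally show ?thesis .
  qed
  then have ee: "e (Suc j) \<otimes> e j = e j" for j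
    using e F by (simp add: e_def[of "Suc j"] l_distr l_minus minus_eq)
  obtain i r where r: "r \<in> carrier R" "e (Suc i) = e i \<otimes> r"
    using acc[of e] e ee by metis
  define j where "j = Suc i"
  have idem_e: "e j \<otimes> e j = e j"
    using r e ee[of i] m_assoc[of "e (Suc i)" "e i" r] by (simp add: j_def)
  define f where "f = F j"
  have f: "f \<in> carrier R" by (simp add: f_def F)
  have e_f: "\<one> \<ominus> e j = f" using F by (simp add: e_def f_def minus_eq minus_add r_neg1 r_neg2)
  have ff: "f \<otimes> f = f"
    unfolding e_f[symmetric]
    using e[of j] idem_e by (simp add: minus_eq l_distr r_distr l_minus r_minus r_neg minus_minus)
  have "f \<noteq> \<zero>"
  proof
    assume "f = \<zero>"
    then have "B [^] Suc j = \<zero>" using BF[of j] by (simp add: f_def[symmetric] BC)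
    then show False
      using not_nil[of "n * Suc j"] nat_pow_pow[OF b, of n "Suc j"] by (simp add: B_def)
  qed
  define D E where "D = B [^] j" and "E = C [^] j"
  have D: "D \<in> carrier R" and E: "E \<in> carrier R" by (simp_all add: D_def E_def BC)
  have ED: "E \<otimes> D = f" by (simp add: f_def F_def D_def E_def)
  define g where "g = D \<otimes> f \<otimes> E"
  have "g \<otimes> g = D \<otimes> (f \<otimes> (E \<otimes> D) \<otimes> f) \<otimes> E" using D E f by (simp add: g_def m_assoc)
  also have "\<dots> = g" by (simp add: ED ff g_def)
  finally have gg: "g \<otimes> g = g" .
  have "E \<otimes> g \<otimes> D = (E \<otimes> D) \<otimes> f \<otimes> (E \<otimes> D)" using D E f by (simp add: g_def m_assoc)
  also have "\<dots> = f" by (simp add: ED ff)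
  finally have "g \<noteq> \<zero>" using \<open>f \<noteq> \<zero>\<close> D E by auto
  obtain l where "n * j = Suc l" by (cases "n * j") (auto simp: n_def j_def)
  then have "D = b \<otimes> b [^] l"
    using nat_pow_pow[OF b, of n j] nat_pow_Suc2[OF b, of l] by (simp add: D_def B_def)
  then have "g = b \<otimes> (b [^] l \<otimes> f \<otimes> E)" using b f E by (simp add: g_def m_assoc)
  then show ?thesis
    using gg \<open>g \<noteq> \<zero>\<close> b f E by (intro bexI[of _ "b [^] l \<otimes> f \<otimes> E"]) auto
qed

text \<open>
  An idempotent \<open>e\<close> in a right ideal \<open>I\<close> with \<open>eR\<close> maximal generates \<open>I\<close>: otherwise \<open>I\<close> contains some
  \<open>y \<noteq> \<zero>\<close> with \<open>e y = \<zero>\<close>, hence an idempotent \<open>f \<noteq> \<zero>\<close> with \<open>e f = \<zero>\<close>, and \<open>e \<oplus> f \<ominus> f e\<close> is an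
  idempotent in \<open>I\<close> that generates more.  So every right ideal has the complement \<open>(\<one> \<ominus> e)R\<close>.
\<close>

lemma semisimple_ringI:
  assumes acc: "\<And>m. (\<And>i. m i \<in> carrier R) \<Longrightarrow> (\<And>i. \<exists>a\<in>carrier R. m i = m (Suc i) \<otimes> a) \<Longrightarrow>
      \<exists>n. \<exists>c\<in>carrier R. m (Suc n) = m n \<otimes> c"
    and idem: "\<And>x. x \<in> carrier R \<Longrightarrow> x \<noteq> \<zero> \<Longrightarrow>
      \<exists>r\<in>carrier R. x \<otimes> r \<noteq> \<zero> \<and> (x \<otimes> r) \<otimes> (x \<otimes> r) = x \<otimes> r"
  shows "semisimple_ring R"
  unfolding semisimple_ring_def semisimple_right_module_def
proof (intro allI impI)
  fix I assume "right_submodule I R (regular_right_module R)"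
  then have I: "right_ideal I R" by (simp add: right_ideal_def)
  have Ic: "x \<in> I \<Longrightarrow> x \<in> carrier R" for x using right_ideal_subset[OF I] by blast
  define E where "E = {e \<in> I. e \<otimes> e = e}"
  have "\<exists>e\<in>E. \<forall>g\<in>E. g \<otimes> e = e \<longrightarrow> (\<exists>c\<in>carrier R. g = e \<otimes> c)"
  proof (rule ccontr)
    assume "\<not> ?thesis"
    then obtain next_e where next_e:
      "\<And>e. e \<in> E \<Longrightarrow> next_e e \<in> E"
      "\<And>e. e \<in> E \<Longrightarrow> next_e e \<otimes> e = e"
      "\<And>e c. e \<in> E \<Longrightarrow> c \<in> carrier R \<Longrightarrow> next_e e \<noteq> e \<otimes> c"
      by metis
    define m where "m i = (next_e ^^ i) \<zero>" for i
    have m_Suc: "m (Suc i) = next_e (m i)" for i by (simp add: m_def)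
    have mE: "m i \<in> E" for i
    proof (induction i)
      case 0
      show ?case using right_ideal_zero[OF I] by (simp add: m_def E_def)
    qed (simp add: m_Suc next_e)
    then have mc: "m i \<in> carrier R" for i using Ic by (simp add: E_def)
    have "\<exists>n. \<exists>c\<in>carrier R. m (Suc n) = m n \<otimes> c"
    proof (rule acc[OF mc])
      show "\<exists>a\<in>carrier R. m i = m (Suc i) \<otimes> a" for i
        using next_e(2)[OF mE[of i]] mc[of i] by (intro bexI[of _ "m i"]) (simp_all add: m_Suc)
    qed
    then show False using next_e(3)[OF mE] by (auto simp: m_Suc)
  qed
  then obtain e where e: "e \<in> I" "e \<otimes> e = e"
    and max: "\<And>g. g \<in> I \<Longrightarrow> g \<otimes> g = g \<Longrightarrow> g \<otimes> e = e \<Longrightarrow> \<exists>c\<in>carrier R. g = e \<otimes> c"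
    unfolding E_def by blast
  have ec: "e \<in> carrier R" using e Ic by blast
  have fixed: "e \<otimes> x = x" if x: "x \<in> I" for x
  proof (rule ccontr)
    assume ne: "e \<otimes> x \<noteq> x"
    have xc: "x \<in> carrier R" using x Ic by blast
    define y where "y = x \<ominus> e \<otimes> x"
    have yI: "y \<in> I"
      unfolding y_def by (rule right_ideal_diff[OF I x right_ideal_mult[OF I e(1) xc]])
    have "e \<otimes> (e \<otimes> x) = e \<otimes> x" using e(2) ec xc by (simp flip: m_assoc)
    then have ey: "e \<otimes> y = \<zero>"
      using ec xc by (simp add: y_def minus_eq r_distr r_minus r_neg)
    have y0: "y \<noteq> \<zero>" using ne ec xc by (auto simp: y_def)
    obtain r where r: "r \<in> carrier R" "y \<otimes> r \<noteq> \<zero>" "(y \<otimes> r) \<otimes> (y \<otimes> r) = y \<otimes> r"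
      using idem[OF Ic[OF yI] y0] by blast
    define f where "f = y \<otimes> r"
    have fI: "f \<in> I" unfolding f_def by (rule right_ideal_mult[OF I yI r(1)])
    have fc: "f \<in> carrier R" using fI Ic by blast
    have ff: "f \<otimes> f = f" using r by (simp add: f_def)
    have ef: "e \<otimes> f = \<zero>" using ey ec r Ic[OF yI] by (simp add: f_def flip: m_assoc)
    have efx: "e \<otimes> (f \<otimes> z) = \<zero>" if "z \<in> carrier R" for z
      using ef ec fc that by (simp flip: m_assoc)
    have ffx: "f \<otimes> (f \<otimes> z) = f \<otimes> z" if "z \<in> carrier R" for z
      using ff fc that by (simp flip: m_assoc)
    define g where "g = (e \<oplus> f) \<ominus> f \<otimes> e"
    have gI: "g \<in> I"
      unfolding g_def
      by (intro right_ideal_diff[OF I] right_ideal_add[OF I] right_ideal_mult[OF I] e(1) fI ec)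
    have gc: "g \<in> carrier R" using gI Ic by blast
    have ge: "g \<otimes> e = e"
      using ec fc e(2) by (simp add: g_def minus_eq l_distr l_minus m_assoc a_assoc r_neg)
    have gf: "g \<otimes> f = f"
      using ec fc by (simp add: g_def minus_eq l_distr l_minus m_assoc ef ff)
    have "g \<otimes> ((e \<oplus> f) \<ominus> f \<otimes> e) = (g \<otimes> e \<oplus> g \<otimes> f) \<ominus> (g \<otimes> f) \<otimes> e"
      using ec fc gc by (simp add: minus_eq r_distr r_minus m_assoc)
    then have "g \<otimes> g = (e \<oplus> f) \<ominus> f \<otimes> e" unfolding ge gf by (simp only: g_def)
    then have "g \<otimes> g = g" by (simp only: g_def)
    then obtain c where c: "c \<in> carrier R" "g = e \<otimes> c" using max gI ge by blast
    have "e \<otimes> g = g" using c ec e(2) by (simp flip: m_assoc)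
    moreover have "e \<otimes> g = e"
      using ec fc e(2) by (simp add: g_def minus_eq r_distr r_minus ef efx)
    ultimately have "f = e \<otimes> f" using gf by simp
    then show False using ef r(2) by (simp add: f_def)
  qed
  let ?K = "{x \<in> carrier R. e \<otimes> x = \<zero>}"
  have "right_ideal ?K R"
  proof (rule right_idealI)
    show "x \<otimes> a \<in> ?K" if "x \<in> ?K" "a \<in> carrier R" for x a
      using that ec by (simp flip: m_assoc)
  qed (use ec in \<open>auto simp: r_distr\<close>)
  moreover have "I \<inter> ?K = {\<zero>}"
    using fixed right_ideal_zero[OF I] ec by auto
  moreover have "I <+>\<^bsub>regular_right_module R\<^esub> ?K = carrier R"
  proof
    show "I <+>\<^bsub>regular_right_module R\<^esub> ?K \<subseteq> carrier R"
      using Ic by (auto simp: set_add_def set_mult_def)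
    show "carrier R \<subseteq> I <+>\<^bsub>regular_right_module R\<^esub> ?K"
    proof
      fix x assume x: "x \<in> carrier R"
      have "e \<otimes> (e \<otimes> x) = e \<otimes> x" using e(2) ec x by (simp flip: m_assoc)
      then have "x \<ominus> e \<otimes> x \<in> ?K"
        using ec x by (simp add: minus_eq r_distr r_minus r_neg)
      moreover have "e \<otimes> x \<in> I" by (rule right_ideal_mult[OF I e(1) x])
      moreover have "x = e \<otimes> x \<oplus> (x \<ominus> e \<otimes> x)"
        using ec x by (simp add: minus_eq a_comm[of x] r_neg1 flip: a_assoc add: r_neg)
      ultimately show "x \<in> I <+>\<^bsub>regular_right_module R\<^esub> ?K"
        unfolding set_add_def set_mult_def by auto
    qed
  qed
  ultimately show "\<exists>N'. right_submodule N' R (regular_right_module R) \<and>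
      I \<inter> N' = {\<zero>\<^bsub>regular_right_module R\<^esub>} \<and>
      I <+>\<^bsub>regular_right_module R\<^esub> N' = carrier (regular_right_module R)"
    by (intro exI[of _ ?K]) (simp add: right_ideal_def)
qed

text \<open>
  The chain conditions hold in \<open>R/J\<close> because its modules are \<open>R\<close>-modules, and a nonzero element of
  \<open>R/J\<close> has a non-nilpotent right multiple, whose right ideal contains the required idempotent.
\<close>

lemma semisimple_modulo_radical:
  assumes large: "large_universe TYPE('m) R" and rwb: "all_right_modules_rwb TYPE('m) R"
  shows "semisimple_ring (R Quot jacobson_radical R)"
proof -
  let ?J = "jacobson_radical R"
  interpret J: ideal ?J R by (rule ideal_jacobson_radical)
  interpret S: ring "R Quot ?J" by (rule J.quotient_is_ring)
  interpret pi: ring_hom_ring R "R Quot ?J" "\<lambda>a. ?J +> a" by (rule J.rcos_ring_hom_ring)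
  have "carrier (R Quot ?J) \<lesssim> carrier R"
    unfolding carrier_FactRing by (rule image_lepoll)
  then have "(UNIV :: nat set) \<times> carrier (R Quot ?J) \<lesssim> (UNIV :: nat set) \<times> carrier R"
    by (intro times_lepoll_mono) auto
  then have large': "large_universe TYPE('m) (R Quot ?J)"
    using large lepoll_trans unfolding large_universe_def by blast
  note rwb' = all_right_modules_rwb_quotient[OF J.ideal_axioms rwb]
  note acc = S.principal_right_ideal_chain_stationary[OF large' rwb']
  show ?thesis
  proof (rule S.semisimple_ringI[OF acc])
    fix A assume A: "A \<in> carrier (R Quot ?J)" "A \<noteq> \<zero>\<^bsub>R Quot ?J\<^esub>"
    then obtain x where x: "x \<in> carrier R" "A = ?J +> x" by (auto simp: carrier_FactRing)
    have zero_iff: "?J +> y = \<zero>\<^bsub>R Quot ?J\<^esub> \<longleftrightarrow> y \<in> ?J" if "y \<in> carrier R" for y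
    proof -
      have "?J +> y = ?J \<longleftrightarrow> y \<in> ?J"
      proof
        assume "?J +> y = ?J"
        then show "y \<in> ?J" using J.a_rcos_self[OF that] by (rule subst)
      qed (rule J.a_rcos_const)
      then show ?thesis unfolding zero_FactRing .
    qed
    obtain r where r: "r \<in> carrier R" "\<And>n::nat. (x \<otimes> r) [^] n \<notin> ?J"
      using not_nil_modulo_radical[OF x(1)] A(2) zero_iff[OF x(1)] x(2) by auto
    define b where "b = A \<otimes>\<^bsub>R Quot ?J\<^esub> (?J +> r)"
    have b_eq: "b = ?J +> (x \<otimes> r)" using x r by (simp add: b_def)
    have b: "b \<in> carrier (R Quot ?J)" using x r by (simp add: b_eq)
    have "b [^]\<^bsub>R Quot ?J\<^esub> n = ?J +> ((x \<otimes> r) [^] n)" for n :: nat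
      unfolding b_eq using x r by (induction n) simp_all
    then have not_nil: "b [^]\<^bsub>R Quot ?J\<^esub> n \<noteq> \<zero>\<^bsub>R Quot ?J\<^esub>" for n :: nat
      using r x zero_iff by simp
    obtain k :: nat and c where c: "c \<in> carrier (R Quot ?J)"
      "b [^]\<^bsub>R Quot ?J\<^esub> k = b [^]\<^bsub>R Quot ?J\<^esub> Suc k \<otimes>\<^bsub>R Quot ?J\<^esub> c"
      using S.power_divisible[OF large' rwb' b] by (elim exE bexE)
    obtain s where s: "s \<in> carrier (R Quot ?J)" "b \<otimes>\<^bsub>R Quot ?J\<^esub> s \<noteq> \<zero>\<^bsub>R Quot ?J\<^esub>"
      "(b \<otimes>\<^bsub>R Quot ?J\<^esub> s) \<otimes>\<^bsub>R Quot ?J\<^esub> (b \<otimes>\<^bsub>R Quot ?J\<^esub> s) = b \<otimes>\<^bsub>R Quot ?J\<^esub> s"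
      using S.idempotent_multiple_exists[OF acc b not_nil c] by auto
    have rc: "?J +> r \<in> carrier (R Quot ?J)" using r by simp
    have "b \<otimes>\<^bsub>R Quot ?J\<^esub> s = A \<otimes>\<^bsub>R Quot ?J\<^esub> ((?J +> r) \<otimes>\<^bsub>R Quot ?J\<^esub> s)"
      unfolding b_def by (rule S.m_assoc[OF A(1) rc s(1)])
    then show "\<exists>s\<in>carrier (R Quot ?J). A \<otimes>\<^bsub>R Quot ?J\<^esub> s \<noteq> \<zero>\<^bsub>R Quot ?J\<^esub> \<and>
        (A \<otimes>\<^bsub>R Quot ?J\<^esub> s) \<otimes>\<^bsub>R Quot ?J\<^esub> (A \<otimes>\<^bsub>R Quot ?J\<^esub> s) = A \<otimes>\<^bsub>R Quot ?J\<^esub> s"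
      using s S.m_closed[OF rc s(1)] by metis
  qed
qed

end

section \<open>Lifting weak bases modulo the radical\<close>

text \<open>
  The finite sums of products of module elements with elements of \<open>J\<close>; for a right ideal \<open>J\<close> this is
  the submodule \<open>MJ\<close>.
\<close>

inductive_set ideal_product ::
    "('a, 'b, 'd) right_module_scheme \<Rightarrow> 'a set \<Rightarrow> 'b set" for M J where
  zero: "\<zero>\<^bsub>M\<^esub> \<in> ideal_product M J"
| add: "u \<in> ideal_product M J \<Longrightarrow> y \<in> carrier M \<Longrightarrow> j \<in> J \<Longrightarrow>
    u \<oplus>\<^bsub>M\<^esub> (y \<cdot>\<^bsub>M\<^esub> j) \<in> ideal_product M J"

context right_module
begin

lemma ideal_product_subset:
  assumes "J \<subseteq> carrier R"
  shows "ideal_product M J \<subseteq> carrier M"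
proof
  fix u assume "u \<in> ideal_product M J"
  then show "u \<in> carrier M"
    by induction (use assms in \<open>auto intro: rsmult_closed\<close>)
qed

lemma right_submodule_ideal_product:
  assumes J: "right_ideal J R"
  shows "right_submodule (ideal_product M J) R M"
proof -
  note Jc = R.right_ideal_subset[OF J]
  note sub = ideal_product_subset[OF Jc]
  show ?thesis
  proof (rule right_submoduleI)
    fix u v assume u: "u \<in> ideal_product M J" and "v \<in> ideal_product M J"
    from this(2) show "u \<oplus>\<^bsub>M\<^esub> v \<in> ideal_product M J"
    proof induction
      case zero
      then show ?case using u sub by auto
    next
      case (add v y j)
      have "u \<in> carrier M" "v \<in> carrier M" using u add.hyps(1) sub by blast+
      moreover have "y \<cdot>\<^bsub>M\<^esub> j \<in> carrier M" using add.hyps Jc by (auto intro: rsmult_closed)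
      ultimately have "u \<oplus>\<^bsub>M\<^esub> (v \<oplus>\<^bsub>M\<^esub> (y \<cdot>\<^bsub>M\<^esub> j)) = (u \<oplus>\<^bsub>M\<^esub> v) \<oplus>\<^bsub>M\<^esub> (y \<cdot>\<^bsub>M\<^esub> j)"
        by (simp add: M.a_assoc)
      then show ?case using ideal_product.add[OF add.IH add.hyps(2,3)] by simp
    qed
  next
    fix u a assume "u \<in> ideal_product M J" and a: "a \<in> carrier R"
    then show "u \<cdot>\<^bsub>M\<^esub> a \<in> ideal_product M J"
    proof induction
      case zero
      then show ?case using a by (simp add: rsmult_zero_left ideal_product.zero)
    next
      case (add u y j)
      have j: "j \<in> carrier R" using add.hyps(3) Jc by blast
      have "u \<in> carrier M" using add.hyps(1) sub by blast
      then have "(u \<oplus>\<^bsub>M\<^esub> (y \<cdot>\<^bsub>M\<^esub> j)) \<cdot>\<^bsub>M\<^esub> a = (u \<cdot>\<^bsub>M\<^esub> a) \<oplus>\<^bsub>M\<^esub> (y \<cdot>\<^bsub>M\<^esub> (j \<otimes>\<^bsub>R\<^esub> a))"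
        using add.hyps(2) j a by (simp add: rsmult_add_module rsmult_assoc rsmult_closed)
      moreover have "j \<otimes>\<^bsub>R\<^esub> a \<in> J" by (rule R.right_ideal_mult[OF J add.hyps(3) a])
      ultimately show ?case using ideal_product.add[OF add.IH[OF a] add.hyps(2)] by simp
    qed
  qed (use sub ideal_product.zero in auto)
qed

text \<open>
  Nakayama's lemma for T-nilpotent \<open>J\<close>.  If \<open>y \<cdot> p \<notin> N\<close>, then, because \<open>y\<close> is a sum of an element of
  \<open>N\<close> and of products \<open>y' \<cdot> j\<close>, one of the elements \<open>y' \<cdot> (j \<otimes> p)\<close> is outside \<open>N\<close>.  Repeating this
  yields elements of \<open>J\<close> all of whose products \<open>a n \<otimes> \<dots> \<otimes> a 1\<close> are nonzero.
\<close>

lemma T_nilpotent_Nakayama: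
  assumes J: "J \<subseteq> carrier R" and nilp: "right_T_nilpotent R J"
    and N: "right_submodule N R M"
    and cover: "\<And>x. x \<in> carrier M \<Longrightarrow> \<exists>n\<in>N. x \<ominus>\<^bsub>M\<^esub> n \<in> ideal_product M J"
  shows "N = carrier M"
proof (rule ccontr)
  assume "N \<noteq> carrier M"
  then obtain x where x: "x \<in> carrier M" "x \<notin> N" using right_submodule_subset[OF N] by blast
  note Nc = subsetD[OF right_submodule_subset[OF N]]
  define good where "good p \<longleftrightarrow> p \<in> carrier R \<and> (\<exists>y\<in>carrier M. y \<cdot>\<^bsub>M\<^esub> p \<notin> N)" for p
  have step: "\<exists>j\<in>J. good (j \<otimes>\<^bsub>R\<^esub> p)" if "good p" for p
  proof (rule ccontr)
    assume bad: "\<not> ?thesis"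
    have p: "p \<in> carrier R" using that by (simp add: good_def)
    have mult: "y \<cdot>\<^bsub>M\<^esub> (j \<otimes>\<^bsub>R\<^esub> p) \<in> N" if "y \<in> carrier M" "j \<in> J" for y j
      using bad that p J R.m_closed by (auto simp: good_def)
    have prod: "u \<cdot>\<^bsub>M\<^esub> p \<in> N" if "u \<in> ideal_product M J" for u
      using that
    proof induction
      case zero
      then show ?case using p right_submodule_zero[OF N] by (simp add: rsmult_zero_left)
    next
      case (add u y j)
      have j: "j \<in> carrier R" using add.hyps(3) J by blast
      have "u \<in> carrier M" using add.hyps(1) ideal_product_subset[OF J] by blast
      then have "(u \<oplus>\<^bsub>M\<^esub> (y \<cdot>\<^bsub>M\<^esub> j)) \<cdot>\<^bsub>M\<^esub> p = (u \<cdot>\<^bsub>M\<^esub> p) \<oplus>\<^bsub>M\<^esub> (y \<cdot>\<^bsub>M\<^esub> (j \<otimes>\<^bsub>R\<^esub> p))"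
        using add.hyps(2) j p by (simp add: rsmult_add_module rsmult_assoc rsmult_closed)
      then show ?case
        using right_submodule_add[OF N add.IH mult[OF add.hyps(2,3)]] by simp
    qed
    have "y \<cdot>\<^bsub>M\<^esub> p \<in> N" if y: "y \<in> carrier M" for y
    proof -
      obtain n where n: "n \<in> N" "y \<ominus>\<^bsub>M\<^esub> n \<in> ideal_product M J" using cover[OF y] by blast
      have "(y \<ominus>\<^bsub>M\<^esub> n) \<oplus>\<^bsub>M\<^esub> n = y" using y Nc[OF n(1)] by (simp add: a_minus_def M.a_assoc M.l_neg)
      then have "y \<cdot>\<^bsub>M\<^esub> p = ((y \<ominus>\<^bsub>M\<^esub> n) \<cdot>\<^bsub>M\<^esub> p) \<oplus>\<^bsub>M\<^esub> (n \<cdot>\<^bsub>M\<^esub> p)"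
        using rsmult_add_module[of "y \<ominus>\<^bsub>M\<^esub> n" n p] y Nc[OF n(1)] p by simp
      then show ?thesis
        using right_submodule_add[OF N prod[OF n(2)] right_submodule_rsmult[OF N n(1) p]] by simp
    qed
    then show False using that by (auto simp: good_def)
  qed
  then obtain next_j where next_j: "\<And>p. good p \<Longrightarrow> next_j p \<in> J"
    "\<And>p. good p \<Longrightarrow> good (next_j p \<otimes>\<^bsub>R\<^esub> p)"
    by metis
  define p where "p = rec_nat \<one>\<^bsub>R\<^esub> (\<lambda>_ p. next_j p \<otimes>\<^bsub>R\<^esub> p)"
  have p_simps: "p 0 = \<one>\<^bsub>R\<^esub>" "p (Suc n) = next_j (p n) \<otimes>\<^bsub>R\<^esub> p n" for n
    by (simp_all add: p_def)
  have good: "good (p n)" for n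
  proof (induction n)
    case 0
    then show ?case using x by (auto simp: p_simps good_def rsmult_one intro!: bexI[of _ x])
  qed (simp add: p_simps next_j)
  \<comment> \<open>The products start with \<open>a 1\<close>, which therefore belongs to \<open>p 0\<close>.\<close>
  define a where "a i = next_j (p (i - 1))" for i :: nat
  have "rev_prod R a n = p n" for n by (induction n) (simp_all add: p_simps a_def)
  moreover have "a i \<in> J" for i using next_j(1)[OF good] by (simp add: a_def)
  ultimately have "\<exists>n. p n = \<zero>\<^bsub>R\<^esub>" using nilp unfolding right_T_nilpotent_def by metis
  then obtain n where "p n = \<zero>\<^bsub>R\<^esub>" ..
  then show False
    using good[of n] right_submodule_zero[OF N] by (auto simp: good_def rsmult_zero_right)
qed

end

text \<open>
  For a module \<open>M\<close> generated by \<open>X\<close>, a weak basis of \<open>M/MJ\<close> inside the image of \<open>X\<close> is lifted to a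
  subset of \<open>X\<close>.  It stays weakly independent, and it generates \<open>M\<close> by Nakayama's lemma.  The
  quotient consists of chosen representatives, so that it lives in the same type as \<open>M\<close>.
\<close>

lemma all_right_modules_rwb_lift:
  fixes R :: "('a, 'c) ring_scheme"
  assumes J: "ideal J R" and nilp: "right_T_nilpotent R J"
    and rwb: "all_right_modules_rwb TYPE('m) (R Quot J)"
  shows "all_right_modules_rwb TYPE('m) R"
  unfolding all_right_modules_rwb_def regularly_weakly_based_def
proof (intro allI impI)
  fix M :: "('a, 'm) right_module" and X
  assume M: "right_module R M" and gen: "generates R M X"
  interpret M: right_module R M by (rule M)
  interpret J: ideal J R by (rule J)
  have Jr: "right_ideal J R"
    by (rule M.R.right_idealI)
      (auto simp: J.a_Hcarr intro: J.a_closed J.I_r_closed additive_subgroup.zero_closed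
        J.additive_subgroup_axioms)
  let ?Z = "ideal_product M J"
  have Z: "right_submodule ?Z R M" by (rule M.right_submodule_ideal_product[OF Jr])
  have refl: "x \<ominus>\<^bsub>M\<^esub> x \<in> ?Z" if "x \<in> carrier M" for x
    using that M.right_submodule_zero[OF Z] by (simp add: a_minus_def M.M.r_neg)
  define q where "q x = (SOME y. y \<in> carrier M \<and> x \<ominus>\<^bsub>M\<^esub> y \<in> ?Z)" for x
  have q: "q x \<in> carrier M" "x \<ominus>\<^bsub>M\<^esub> q x \<in> ?Z" if "x \<in> carrier M" for x
    using someI[of "\<lambda>y. y \<in> carrier M \<and> x \<ominus>\<^bsub>M\<^esub> y \<in> ?Z" x] that refl[OF that]
    by (simp_all add: q_def)
  interpret Q: coset_map R M "carrier M" ?Z q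
  proof (intro coset_map.intro coset_map_axioms.intro M Z M.right_submodule_carrier iffI)
    fix x y assume x: "x \<in> carrier M" and y: "y \<in> carrier M"
    note trans = M.diff_submodule_trans[OF Z] and sym = M.diff_submodule_sym[OF Z]
    show "x \<ominus>\<^bsub>M\<^esub> y \<in> ?Z" if "q x = q y"
    proof -
      have "q x \<ominus>\<^bsub>M\<^esub> y \<in> ?Z" unfolding that by (rule sym[OF y q[OF y]])
      then show ?thesis by (rule trans[OF x q(1)[OF x] y q(2)[OF x]])
    qed
    show "q x = q y" if xy: "x \<ominus>\<^bsub>M\<^esub> y \<in> ?Z"
    proof -
      have "z \<in> carrier M \<and> x \<ominus>\<^bsub>M\<^esub> z \<in> ?Z \<longleftrightarrow> z \<in> carrier M \<and> y \<ominus>\<^bsub>M\<^esub> z \<in> ?Z" for z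
        using trans[OF x y _ xy] trans[OF y x _ sym[OF x y xy]] by blast
      then show ?thesis by (simp add: q_def)
    qed
  qed
  let ?Q = "image_module M (carrier M) q"
  interpret Q: right_module R ?Q by (rule Q.right_module_image)
  have "regularly_weakly_based R ?Q"
  proof (rule regularly_weakly_based_deflate[OF J Q.right_module_image _ rwb])
    fix u j assume "u \<in> carrier ?Q" and j: "j \<in> J"
    then obtain x where x: "x \<in> carrier M" "u = q x" by auto
    have jc: "j \<in> carrier R" using j by (rule J.a_Hcarr)
    have xj: "x \<cdot>\<^bsub>M\<^esub> j \<in> carrier M" by (rule M.rsmult_closed[OF x(1) jc])
    have "\<zero>\<^bsub>M\<^esub> \<oplus>\<^bsub>M\<^esub> (x \<cdot>\<^bsub>M\<^esub> j) \<in> ?Z"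
      by (rule ideal_product.add[OF ideal_product.zero x(1) j])
    then have "q (x \<cdot>\<^bsub>M\<^esub> j) = q \<zero>\<^bsub>M\<^esub>"
      using Q.q_eq_iff[OF xj M.M.zero_closed] xj by (simp add: a_minus_def M.M.minus_equality[of "\<zero>\<^bsub>M\<^esub>" "\<zero>\<^bsub>M\<^esub>"])
    then show "u \<cdot>\<^bsub>?Q\<^esub> j = \<zero>\<^bsub>?Q\<^esub>" using Q.q_rsmult[OF x(1) jc] x(2) by simp
  qed
  moreover have X: "X \<subseteq> carrier M" "Span R M X = carrier M" using gen by (auto simp: generates_def)
  then have "generates R ?Q (q ` X)" using Q.Span_image by (auto simp: generates_def)
  ultimately obtain B' where B': "B' \<subseteq> q ` X" "weak_basis R ?Q B'"
    unfolding regularly_weakly_based_def by blast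
  then obtain B where B: "B \<subseteq> X" "inj_on q B" "B' = q ` B" by (auto simp: subset_image_inj)
  have Bc: "B \<subseteq> carrier M" using B X by blast
  have "weakly_independent R M B"
    unfolding weakly_independent_def
  proof (intro conjI ballI notI Bc)
    fix x assume x: "x \<in> B" "x \<in> Span R M (B - {x})"
    have "q x \<in> Span R ?Q (q ` (B - {x}))" using x Bc Q.Span_image[of "B - {x}"] by blast
    also have "q ` (B - {x}) = B' - {q x}" using B x by (auto simp: inj_on_def)
    finally show False
      using B' B(3) x(1) by (auto simp: weak_basis_def weakly_independent_def)
  qed
  moreover have "Span R M B = carrier M"
  proof (rule M.T_nilpotent_Nakayama[OF M.R.right_ideal_subset[OF Jr] nilp])
    show SB: "right_submodule (Span R M B) R M" by (rule M.right_submodule_Span[OF Bc])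
    fix x assume x: "x \<in> carrier M"
    have "q x \<in> Span R ?Q (q ` B)" using B' B(3) x by (auto simp: weak_basis_def generates_def)
    then obtain n where n: "n \<in> Span R M B" "q x = q n" using Q.Span_image[OF Bc] by auto
    then have "n \<in> carrier M" using M.right_submodule_subset[OF SB] by blast
    then show "\<exists>n\<in>Span R M B. x \<ominus>\<^bsub>M\<^esub> n \<in> ?Z" using n Q.q_eq_iff[OF x] by blast
  qed
  ultimately show "\<exists>B\<subseteq>X. weak_basis R M B"
    using B(1) Bc by (auto simp: weak_basis_def generates_def)
qed

theorem proposition2p4:
  fixes R :: "('a, 'c) ring_scheme"
  assumes "ring R"
  shows "(large_universe TYPE('m) R \<longrightarrow>
            all_right_modules_rwb TYPE('m) R \<longrightarrow> right_perfect R)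
       \<and> (right_perfect R \<longrightarrow>
            (all_right_modules_rwb TYPE('m) R \<longleftrightarrow>
             all_right_modules_rwb TYPE('m) (R Quot jacobson_radical R)))"
proof -
  interpret ring R by fact
  show ?thesis
    using radical_right_T_nilpotent[where 'm = 'm] semisimple_modulo_radical[where 'm = 'm]
      all_right_modules_rwb_quotient[OF ideal_jacobson_radical, where 'm = 'm]
      all_right_modules_rwb_lift[OF ideal_jacobson_radical, where 'm = 'm]
    unfolding right_perfect_def by blast
qed

end
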